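(* Let $D$ be a positive integer, let $(Z,\mathbb{Z}^k,S)$ be an aperiodic zero-dimensional system, and let $\pi:X\to Z$ be an extension, where $(X,\mathbb{Z}^k,T)$ is a dynamical system with $\mathrm{mdim}(X)<D/2$. Then for a dense $G_\delta$ subset of $f\in C(X,[0,1]^D)$ the map $(I_f,\pi):X\to([0,1]^D)^{\mathbb{Z}^k}\times Z$, $x\mapsto(I_f(x),\pi(x))$, is a topological embedding.
   Context: Dynamical system: compact metric space with continuous $\mathbb{Z}^k$-action. Aperiodic: the action is free. Zero-dimensional: clopen subsets form a basis of the topology. An extension $\pi:X\to Z$ is a $\mathbb{Z}^k$-equivariant continuous surjection. $C(X,[0,1]^D)$ carries the uniform topology. $I_f(x)=(f(T^nx))_{n\in\mathbb{Z}^k}$. Mean dimension: with $[N]=\{0,\dots,N-1\}^k$, $d_\Omega(x,y)=\sup_{n\in\Omega}d(T^nx,T^ny)$, a continuous $f:(X,d)\to Y$ is an $\varepsilon$-embedding if $\mathrm{diam}\,f^{-1}(y)<\varepsilon$ for all $y$, $\mathrm{widim}_\varepsilon(X,d)$ is the minimal dimension of a finite simplicial complex admitting an $\varepsilon$-embedding, and $\mathrm{mdim}(X)=\lim_{\varepsilon\to0}\lim_{N\to\infty}N^{-k}\mathrm{widim}_\varepsilon(X,d_{[N]})$. *)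

theory Defs
  imports "HOL-Analysis.Analysis"
begin

text \<open>Group Z^k is rendered as the type int^'k, with k = CARD('k).
  A compact metric space is rendered as a metric_space type whose UNIV is compact.\<close>

definition zk_action :: "(int^'k \<Rightarrow> 'a::topological_space \<Rightarrow> 'a) \<Rightarrow> bool" where
  "zk_action T \<longleftrightarrow> (\<forall>n. continuous_on UNIV (T n)) \<and> T 0 = id \<and>
     (\<forall>m n. T (m + n) = T m \<circ> T n)"

definition dyn_system :: "(int^'k \<Rightarrow> 'a::metric_space \<Rightarrow> 'a) \<Rightarrow> bool" where
  "dyn_system T \<longleftrightarrow> compact (UNIV :: 'a set) \<and> zk_action T"

definition aperiodic :: "(int^'k \<Rightarrow> 'a \<Rightarrow> 'a) \<Rightarrow> bool" where
  "aperiodic T \<longleftrightarrow> (\<forall>x n. T n x = x \<longrightarrow> n = 0)"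

definition zero_dimensional_space :: "'a::topological_space itself \<Rightarrow> bool" where
  "zero_dimensional_space _ \<longleftrightarrow>
     (\<forall>U::'a set. \<forall>x\<in>U. open U \<longrightarrow> (\<exists>V. open V \<and> closed V \<and> x \<in> V \<and> V \<subseteq> U))"

definition extension ::
  "(int^'k \<Rightarrow> 'a::topological_space \<Rightarrow> 'a) \<Rightarrow> (int^'k \<Rightarrow> 'z::topological_space \<Rightarrow> 'z) \<Rightarrow> ('a \<Rightarrow> 'z) \<Rightarrow> bool" where
  "extension T S \<pi> \<longleftrightarrow> continuous_on UNIV \<pi> \<and> surj \<pi> \<and> (\<forall>n x. \<pi> (T n x) = S n (\<pi> x))"

definition box :: "nat \<Rightarrow> (int^'k) set" where
  "box N = {n. \<forall>i. 0 \<le> n $ i \<and> n $ i < int N}"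

definition dOmega :: "(int^'k \<Rightarrow> 'a::metric_space \<Rightarrow> 'a) \<Rightarrow> (int^'k) set \<Rightarrow> 'a \<Rightarrow> 'a \<Rightarrow> real" where
  "dOmega T \<Omega> x y = (SUP n\<in>\<Omega>. dist (T n x) (T n y))"

definition diam_wrt :: "('a \<Rightarrow> 'a \<Rightarrow> real) \<Rightarrow> 'a set \<Rightarrow> real" where
  "diam_wrt d A = (if A = {} then 0 else (SUP p\<in>A \<times> A. d (fst p) (snd p)))"

definition fin_simplicial_complex :: "nat set set \<Rightarrow> bool" where
  "fin_simplicial_complex K \<longleftrightarrow> finite K \<and> (\<forall>\<sigma>\<in>K. finite \<sigma> \<and> \<sigma> \<noteq> {}) \<and>
     (\<forall>\<sigma>\<in>K. \<forall>\<tau>. \<tau> \<subseteq> \<sigma> \<and> \<tau> \<noteq> {} \<longrightarrow> \<tau> \<in> K)"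

definition complex_dim_le :: "nat set set \<Rightarrow> nat \<Rightarrow> bool" where
  "complex_dim_le K d \<longleftrightarrow> (\<forall>\<sigma>\<in>K. card \<sigma> \<le> d + 1)"

text \<open>Geometric realisation (barycentric coordinates), with the topology inherited
  from the product topology on nat => real (for finitely many vertices this is the
  usual topology of the polyhedron).\<close>
definition geom_real :: "nat set set \<Rightarrow> (nat \<Rightarrow> real) set" where
  "geom_real K = {t. (\<forall>i. 0 \<le> t i) \<and> {i. t i \<noteq> 0} \<in> K \<and> (\<Sum>i\<in>{i. t i \<noteq> 0}. t i) = 1}"

definition geom_top :: "nat set set \<Rightarrow> (nat \<Rightarrow> real) topology" where
  "geom_top K = subtopology (product_topology (\<lambda>_. euclidean) UNIV) (geom_real K)"

definition eps_embedding ::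
  "('a::topological_space \<Rightarrow> 'a \<Rightarrow> real) \<Rightarrow> real \<Rightarrow> nat set set \<Rightarrow> ('a \<Rightarrow> nat \<Rightarrow> real) \<Rightarrow> bool" where
  "eps_embedding d \<epsilon> K f \<longleftrightarrow> continuous_map euclidean (geom_top K) f \<and>
     (\<forall>y. diam_wrt d (f -` {y}) < \<epsilon>)"

definition widim :: "('a::topological_space \<Rightarrow> 'a \<Rightarrow> real) \<Rightarrow> real \<Rightarrow> nat" where
  "widim d \<epsilon> = (LEAST n. \<exists>K f. fin_simplicial_complex K \<and> complex_dim_le K n \<and> eps_embedding d \<epsilon> K f)"

definition mdim :: "(int^'k \<Rightarrow> 'a::metric_space \<Rightarrow> 'a) \<Rightarrow> ereal" where
  "mdim T = Lim (at_right (0::real))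
     (\<lambda>\<epsilon>. ereal (lim (\<lambda>N. real (widim (dOmega T (box N)) \<epsilon>) / real N ^ CARD('k))))"

definition unit_cube :: "(real^'d) set" where
  "unit_cube = {y. \<forall>i. 0 \<le> y $ i \<and> y $ i \<le> 1}"

definition CX_top :: "(('a::topological_space \<Rightarrow>\<^sub>C (real^'d)) topology)" where
  "CX_top = top_of_set {f. \<forall>x. apply_bcontfun f x \<in> unit_cube}"

definition I_map :: "(int^'k \<Rightarrow> 'a \<Rightarrow> 'a) \<Rightarrow> ('a \<Rightarrow> 'b) \<Rightarrow> 'a \<Rightarrow> (int^'k \<Rightarrow> 'b)" where
  "I_map T f x = (\<lambda>n. f (T n x))"

end

theory Submission
  imports Defs
begin

text \<open>By the Baire category theorem it suffices that the maps f for which (I_f, \<pi>) has fibres of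
  diameter less than \<epsilon> are dense. Cut Z into finitely many clopen towers whose levels form large
  Voronoi cells W of the orbits. Since mdim is below D/2, the Bowen metric on each cell admits a cover by
  \<epsilon>-small open sets of order m + 1 with 2 m < D |W|. A partition of unity with values at
  affinely generic points of the cube of dimension D |W| therefore encodes a point of X, up to
  \<epsilon>, in D |W| coordinates close to those of f along W. Points with the same image in Z
  see the same towers, so these encodings glue to a perturbation of f. The definition of mdim through
  limits makes sense because widim is subadditive: refining a simplicial complex by families of
  disjoint sets of many colours (Ostrand) avoids triangulating products.\<close>

section \<open>Small covers and maps to simplicial complexes\<close>

text \<open>Gluing needs disjoint tower levels, and these need not exhaust Z: a point tied between
  two centres lies in no open cell. So \<open>f\<close> is changed only on open cells
  \<open>W\<close>, while the encoding of a base point is made fine along the closed cells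
  \<open>W'\<close>, which together reach every point; tied points are decoded without being used as
  coordinates. The price is that the cover is measured along \<open>W'\<close> but coordinates are
  counted on \<open>W\<close>. The gap below D/2 leaves a factor \<open>\<theta>\<close> < 1 for
  this, and cells that are large compared with the box size lose no more. The constant D/2 comes
  from comparing two points: each lies in at most m + 1 sets of the cover, so equal encodings give
  an affine relation among at most 2 m + 2 points, which general position in dimension D |W|
  excludes when 2 m + 2 \<le> D |W| + 1. Aperiodicity separates a point from its translates;
  zero-dimensionality makes the levels clopen, so that a perturbation defined by cases stays
  continuous. Closeness is carried by arbitrary relations because a conjunction of relations then
  corresponds to a union of windows.\<close>

definition fine_cover :: "('a::topological_space \<Rightarrow> 'a \<Rightarrow> bool) \<Rightarrow> nat \<Rightarrow> 'a set set \<Rightarrow> bool" where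
  "fine_cover P m \<V> \<longleftrightarrow> finite \<V> \<and> (\<forall>V\<in>\<V>. open V) \<and> \<Union>\<V> = UNIV \<and>
     (\<forall>V\<in>\<V>. \<forall>x\<in>V. \<forall>y\<in>V. P x y) \<and> (\<forall>x. card {V\<in>\<V>. x \<in> V} \<le> m + 1)"

text \<open>Relational form of an epsilon-embedding into a polyhedron of dimension at most
  \<open>m\<close>; for closeness along a finite nonempty window it is what \<open>widim\<close>
  minimises.\<close>

definition fine_map :: "('a::topological_space \<Rightarrow> 'a \<Rightarrow> bool) \<Rightarrow> nat \<Rightarrow> bool" where
  "fine_map P m \<longleftrightarrow> (\<exists>K f. fin_simplicial_complex K \<and> complex_dim_le K m \<and>
     continuous_map euclidean (geom_top K) f \<and> (\<forall>x y. f x = f y \<longrightarrow> P x y))"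

text \<open>A colour is counted if some coordinate lies on its grid s_c + Z/q; choose such a vertex
  \<open>i c\<close>. It lies in \<open>\<sigma>\<close>, because elsewhere the value is
  \<open>- (s c * q)\<close>, strictly between -1 and 0. Different colours choose different
  vertices, because two offsets times \<open>q\<close> differ by less than 1. This bounds the count
  by m + 1, and equality would make \<open>i\<close> a bijection onto
  \<open>\<sigma>\<close>.\<close>

lemma card_nonintegral_colours:
  fixes t :: "nat \<Rightarrow> real" and s :: "nat \<Rightarrow> real" and q N m :: nat
  assumes \<sigma>: "finite \<sigma>" "card \<sigma> \<le> m + 1" "sum t \<sigma> = 1"
    and zero: "\<And>i. i \<notin> \<sigma> \<Longrightarrow> t i = 0"
    and s: "\<And>c. c < N \<Longrightarrow> 0 < s c * q \<and> s c * q < 1 / (m + 1)" "inj_on s {..<N}"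
  shows "card {c. c < N \<and> (\<exists>i. (t i - s c) * q \<in> \<int>)} \<le> m"
proof -
  define B where "B = {c. c < N \<and> (\<exists>i. (t i - s c) * q \<in> \<int>)}"
  have finB: "finite B" by (auto simp: B_def)
  have "\<forall>c\<in>B. \<exists>i. (t i - s c) * q \<in> \<int>" by (auto simp: B_def)
  then obtain i where i: "\<And>c. c \<in> B \<Longrightarrow> (t (i c) - s c) * q \<in> \<int>" by metis
  have s1: "0 < s c * q" "s c * q < 1" if "c \<in> B" for c
  proof -
    have c: "c < N" using that by (auto simp: B_def)
    show "0 < s c * q" using s(1)[OF c] by simp
    have "s c * q < 1 / (m + 1)" using s(1)[OF c] by simp
    also have "\<dots> \<le> 1" by simp
    finally show "s c * q < 1" .
  qed
  have nonint: "r \<notin> \<int>" if "0 < r" "r < 1" for r :: real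
    using that by (auto elim!: Ints_cases)
  have isig: "i c \<in> \<sigma>" if "c \<in> B" for c
  proof (rule ccontr)
    assume "i c \<notin> \<sigma>"
    then have "- (s c * q) \<in> \<int>" using i[OF that] zero by simp
    then have "s c * q \<in> \<int>" by (simp only: minus_in_Ints_iff)
    then show False using nonint s1[OF that] by blast
  qed
  have inj: "inj_on i B"
  proof (rule inj_onI, rule ccontr)
    fix c c' assume c: "c \<in> B" "c' \<in> B" "i c = i c'" "c \<noteq> c'"
    have "s c \<noteq> s c'" using c s(2) by (auto simp: inj_on_def B_def)
    moreover have "q \<noteq> 0" using s1[OF c(1)] by (cases q) auto
    ultimately have ne: "s c * q \<noteq> s c' * q" by simp
    have "(t (i c) - s c) * q - (t (i c') - s c') * q \<in> \<int>" using i c(1,2) by (intro Ints_diff) blast+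
    then have 1: "s c' * q - s c * q \<in> \<int>" using c(3) by (simp add: algebra_simps)
    then have 2: "s c * q - s c' * q \<in> \<int>" by (metis minus_diff_eq minus_in_Ints_iff)
    show False using nonint[of "s c' * q - s c * q"] nonint[of "s c * q - s c' * q"] 1 2 ne
      s1[OF c(1)] s1[OF c(2)] by linarith
  qed
  have le: "card B \<le> card \<sigma>" using card_inj_on_le[OF inj _ \<sigma>(1)] isig by blast
  have "card B \<noteq> m + 1"
  proof
    assume cB: "card B = m + 1"
    then have im: "i ` B = \<sigma>"
      using \<sigma> isig card_image[OF inj] le by (intro card_subset_eq) auto
    \<comment> \<open>Summed over all of \<open>\<sigma>\<close> the coordinates give 1, so the sum
      of the \<open>s c * q\<close> would be an integer. The bound 1 / (m + 1) on each of the m + 1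
      terms puts it strictly between 0 and 1.\<close>
    have "(\<Sum>c\<in>B. (t (i c) - s c) * q) \<in> \<int>" using i by (intro Ints_sum)
    moreover have "(\<Sum>c\<in>B. t (i c)) = 1"
      using sum.reindex[OF inj, of t] im \<sigma>(3) by (simp add: o_def)
    then have "(\<Sum>c\<in>B. (t (i c) - s c) * q) = q - (\<Sum>c\<in>B. s c * q)"
      by (simp add: algebra_simps sum_subtractf flip: sum_distrib_left)
    ultimately have "real q - (\<Sum>c\<in>B. s c * q) \<in> \<int>" by simp
    then have "real q - (real q - (\<Sum>c\<in>B. s c * q)) \<in> \<int>" by (intro Ints_diff) auto
    then have "(\<Sum>c\<in>B. s c * q) \<in> \<int>" by simp
    moreover have "0 < (\<Sum>c\<in>B. s c * q)"
      using finB cB s1 by (intro sum_pos) (auto simp del: of_nat_Suc)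
    moreover have "(\<Sum>c\<in>B. s c * q) < (\<Sum>c\<in>B. 1 / (m + 1))"
    proof (intro sum_strict_mono)
      show "B \<noteq> {}" using cB by auto
    qed (use finB s(1) in \<open>auto simp: B_def\<close>)
    then have "(\<Sum>c\<in>B. s c * q) < 1" using cB by simp
    ultimately show False using nonint by blast
  qed
  with le \<sigma> show ?thesis unfolding B_def by linarith
qed

text \<open>Ostrand's description of dimension at most \<open>m\<close>: a point may be missed by
  \<open>m\<close> colours, however many colours there are. The freedom in \<open>N\<close> is what
  makes two such systems compatible, since both can be given the same larger number of
  colours.\<close>

definition coloured_family ::
  "('a::topological_space \<Rightarrow> 'a \<Rightarrow> bool) \<Rightarrow> nat \<Rightarrow> nat \<Rightarrow> (nat \<Rightarrow> 'a set set) \<Rightarrow> bool" where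
  "coloured_family P m N \<U> \<longleftrightarrow>
     (\<forall>c. finite (\<U> c) \<and> disjoint (\<U> c) \<and> (\<forall>U\<in>\<U> c. open U \<and> (\<forall>x\<in>U. \<forall>y\<in>U. P x y))) \<and>
     (\<forall>x. card {c. c < N \<and> x \<notin> \<Union>(\<U> c)} \<le> m)"

text \<open>The pairs violating \<open>P\<close> form a compact set, on which the total coordinate
  difference \<open>h\<close> is positive and hence bounded below by its minimum.\<close>

lemma compact_separation:
  fixes f :: "'a::metric_space \<Rightarrow> nat \<Rightarrow> real"
  assumes "compact (UNIV :: 'a set)" "open {p. P (fst p) (snd p)}" "finite I"
    and cont: "\<And>i. i \<in> I \<Longrightarrow> continuous_on UNIV (\<lambda>x. f x i)"
    and inj: "\<And>x y. (\<forall>i\<in>I. f x i = f y i) \<Longrightarrow> P x y"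
  obtains \<delta> where "\<delta> > 0" "\<And>x y. (\<forall>i\<in>I. \<bar>f x i - f y i\<bar> < \<delta>) \<Longrightarrow> P x y"
proof -
  define C where "C = - {p. P (fst p) (snd p)}"
  define h where "h p = (\<Sum>i\<in>I. \<bar>f (fst p) i - f (snd p) i\<bar>)" for p
  have "compact (UNIV :: ('a \<times> 'a) set)"
    using compact_Times[OF assms(1) assms(1)] by simp
  moreover have "closed C" using assms(2) by (simp add: C_def closed_def)
  ultimately have cC: "compact C" using compact_Int_closed[of UNIV C] by simp
  have hcont: "continuous_on A h" for A
    unfolding h_def
    by (intro continuous_intros continuous_on_compose2[OF cont]) auto
  show thesis
  proof (cases "C = {}")
    case True
    have "P x y" for x y
    proof (rule ccontr)
      assume "\<not> P x y"
      then have "(x, y) \<in> C" by (simp add: C_def)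
      then show False using True by simp
    qed
    then show thesis by (intro that[of 1]) auto
  next
    case False
    then obtain p where p: "p \<in> C" "\<And>p'. p' \<in> C \<Longrightarrow> h p \<le> h p'"
      using continuous_attains_inf[OF cC False hcont] by blast
    have "h p \<ge> 0" by (auto simp: h_def intro: sum_nonneg)
    moreover have "h p \<noteq> 0"
    proof
      assume "h p = 0"
      then have "\<forall>i\<in>I. f (fst p) i = f (snd p) i"
        using assms(3) by (auto simp: h_def sum_nonneg_eq_0_iff)
      then show False using inj p(1) by (auto simp: C_def)
    qed
    ultimately have pos: "h p > 0" by simp
    show thesis
    \<comment> \<open>Dividing by one more than the number of coordinates makes the sum of
      \<open>card I\<close> differences strictly smaller than the minimum
      \<open>h p\<close>.\<close>
    proof (rule that[of "h p / (real (card I) + 1)"])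
      show "h p / (real (card I) + 1) > 0" using pos by simp
    next
      fix x y assume *: "\<forall>i\<in>I. \<bar>f x i - f y i\<bar> < h p / (real (card I) + 1)"
      have "h (x,y) \<le> (\<Sum>i\<in>I. h p / (real (card I) + 1))"
        unfolding h_def[of "(x,y)"] fst_conv snd_conv
        by (intro sum_mono less_imp_le) (use * in blast)
      also have "\<dots> = card I * (h p / (real (card I) + 1))" by simp
      also have "\<dots> < h p" using pos by (simp add: field_simps)
      finally have "(x,y) \<notin> C" using p(2) by force
      then show "P x y" by (simp add: C_def)
    qed
  qed
qed

text \<open>The barycentric coordinates are cut at the points of s_c + Z/q. A coordinate vector has at
  most m + 1 nonzero entries with sum 1, and the offsets s_c are so small that
  not all of these entries can lie on cutting points of different colours.\<close>

lemma fine_map_imp_coloured_family: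
  fixes P :: "'a::metric_space \<Rightarrow> 'a \<Rightarrow> bool"
  assumes "compact (UNIV :: 'a set)" "open {p. P (fst p) (snd p)}" "fine_map P m"
  shows "\<exists>\<U>. coloured_family P m N \<U>"
proof -
  obtain K f where K: "fin_simplicial_complex K" "complex_dim_le K m"
    and f: "continuous_map euclidean (geom_top K) f" and inj: "\<And>x y. f x = f y \<Longrightarrow> P x y"
    using assms(3) by (auto simp: fine_map_def)
  define I where "I = \<Union>K"
  have finI: "finite I" using K(1) by (auto simp: I_def fin_simplicial_complex_def)
  have fgeom: "f x \<in> geom_real K" for x
    using f by (auto simp: geom_top_def continuous_map_in_subtopology)
  have fcont: "continuous_on UNIV (\<lambda>x. f x i)" for i
    using f by (auto simp: geom_top_def continuous_map_in_subtopology continuous_map_componentwise_UNIV)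
  have fI: "f x i = 0" if "i \<notin> I" for x i
    using fgeom[of x] that by (auto simp: geom_real_def I_def)
  have finj: "P x y" if "\<forall>i\<in>I. f x i = f y i" for x y
    by (rule inj) (use that fI in \<open>metis ext\<close>)
  obtain \<delta> where \<delta>: "\<delta> > 0" "\<And>x y. (\<forall>i\<in>I. \<bar>f x i - f y i\<bar> < \<delta>) \<Longrightarrow> P x y"
    using compact_separation[OF assms(1,2) finI, of f] fcont finj by blast
  obtain q :: nat where q: "q > 0" "1 / q < \<delta>"
    using real_arch_inverse[of \<delta>] \<delta>(1) by (auto simp: inverse_eq_divide)
  \<comment> \<open>Distinct offsets with 0 < \<open>s c * q\<close> < 1 / (m + 1) for c < N: the
    numerator c + 1 gives positivity, the factor N + 1 the strict upper bound.\<close>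
  define s where "s c = (real c + 1) / ((N + 1) * (m + 1) * q)" for c
  define U where "U c a = {x. \<forall>i\<in>I. real_of_int (a i) < (f x i - s c) * q \<and>
      (f x i - s c) * q < real_of_int (a i) + 1}" for c a
  \<comment> \<open>Coordinates lie in [0,1] and \<open>s c * q\<close> in (0,1), so the floors
    range over -1, ..., q. Indices are extensional, so that agreement on \<open>I\<close> is
    equality; this gives disjointness within a colour.\<close>
  define A where "A = PiE I (\<lambda>_. {-1..int q})"
  define \<U> where "\<U> c = U c ` A" for c
  have finA: "finite A" unfolding A_def by (intro finite_PiE finI) auto
  have fl: "a i = \<lfloor>(f x i - s c) * q\<rfloor>" if "x \<in> U c a" "i \<in> I" for x c a i
  proof -
    have "real_of_int (a i) < (f x i - s c) * q" "(f x i - s c) * q < real_of_int (a i) + 1"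
      using that by (auto simp: U_def)
    then show ?thesis by linarith
  qed
  have close: "P x y" if "x \<in> U c a" "y \<in> U c a" for x y c a
  proof (rule \<delta>(2), intro ballI)
    fix i assume "i \<in> I"
    then have "real_of_int (a i) < (f x i - s c) * q" "(f x i - s c) * q < real_of_int (a i) + 1"
      "real_of_int (a i) < (f y i - s c) * q" "(f y i - s c) * q < real_of_int (a i) + 1"
      using that by (auto simp: U_def)
    then have "\<bar>(f x i - s c) * q - (f y i - s c) * q\<bar> < 1" by linarith
    then have "\<bar>f x i - f y i\<bar> * q < 1"
      by (simp add: abs_mult flip: left_diff_distrib)
    then have "\<bar>f x i - f y i\<bar> < 1 / q" using q by (simp add: field_simps)
    then show "\<bar>f x i - f y i\<bar> < \<delta>" using q by simp
  qed
  have op: "open (U c a)" for c a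
  proof -
    have "U c a = (\<Inter>i\<in>I. {x. real_of_int (a i) < (f x i - s c) * q} \<inter>
        {x. (f x i - s c) * q < real_of_int (a i) + 1})" by (auto simp: U_def)
    also have "open \<dots>" using finI
      by (intro open_INT ballI open_Int open_Collect_less continuous_intros fcont) auto
    finally show ?thesis .
  qed
  have dis: "disjoint (\<U> c)" for c
  proof (rule disjointI)
    fix V W assume "V \<in> \<U> c" "W \<in> \<U> c" "V \<noteq> W"
    then obtain a b where ab: "V = U c a" "W = U c b" "a \<in> A" "b \<in> A" by (auto simp: \<U>_def)
    show "V \<inter> W = {}"
    proof (rule ccontr)
      assume "V \<inter> W \<noteq> {}"
      then obtain x where "x \<in> U c a" "x \<in> U c b" using ab by auto
      then have "\<forall>i\<in>I. a i = b i" using fl by metis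
      then have "a = b" using ab by (auto simp: A_def intro: PiE_ext)
      then show False using \<open>V \<noteq> W\<close> ab by simp
    qed
  qed
  have sb: "0 < s c * q \<and> s c * q < 1 / (m + 1)" if "c < N" for c
  proof -
    have e: "s c * q = (real c + 1) / (real N + 1) * (1 / (m + 1))"
      using q unfolding s_def of_nat_mult by (simp add: add.commute)
    have "(real c + 1) / (real N + 1) < 1" using that by simp
    then have "(real c + 1) / (real N + 1) * (1 / (m + 1)) < 1 * (1 / (m + 1))"
      by (intro mult_strict_right_mono) auto
    then show ?thesis unfolding e by simp
  qed
  have "real ((N + 1) * (m + 1) * q) \<noteq> 0" using q unfolding of_nat_eq_0_iff by simp
  then have sinj: "inj_on s {..<N}" unfolding s_def inj_on_def by (simp del: of_nat_mult)
  have bad: "card {c. c < N \<and> x \<notin> \<Union>(\<U> c)} \<le> m" for x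
  proof -
    have f0: "0 \<le> f x i" for i using fgeom[of x] by (auto simp: geom_real_def)
    define \<sigma> where "\<sigma> = {i. f x i \<noteq> 0}"
    have \<sigma>K: "\<sigma> \<in> K" and s1: "sum (f x) \<sigma> = 1"
      using fgeom[of x] by (auto simp: geom_real_def \<sigma>_def)
    have fin\<sigma>: "finite \<sigma>" using K(1) \<sigma>K unfolding fin_simplicial_complex_def by blast
    have c\<sigma>: "card \<sigma> \<le> m + 1" using K(2) \<sigma>K unfolding complex_dim_le_def by blast
    have f1: "f x i \<le> 1" for i
    proof (cases "i \<in> \<sigma>")
      case True
      then show ?thesis using member_le_sum[of i \<sigma> "f x"] f0 fin\<sigma> s1 by auto
    qed (auto simp: \<sigma>_def)
    have sub: "{c. c < N \<and> x \<notin> \<Union>(\<U> c)} \<subseteq> {c. c < N \<and> (\<exists>i. (f x i - s c) * q \<in> \<int>)}"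
    proof safe
      fix c assume c: "c < N" "x \<notin> \<Union>(\<U> c)"
      show "\<exists>i. (f x i - s c) * q \<in> \<int>"
      proof (rule ccontr)
        assume no: "\<not> ?thesis"
        define a where "a = restrict (\<lambda>i. \<lfloor>(f x i - s c) * q\<rfloor>) I"
        have "x \<in> U c a"
          unfolding U_def
        proof (intro CollectI ballI conjI)
          fix i assume "i \<in> I"
          then have ai: "a i = \<lfloor>(f x i - s c) * q\<rfloor>" by (simp add: a_def)
          have "of_int \<lfloor>(f x i - s c) * q\<rfloor> \<noteq> (f x i - s c) * q" using no by (metis Ints_of_int)
          then show "real_of_int (a i) < (f x i - s c) * q"
            unfolding ai using of_int_floor_le[of "(f x i - s c) * q"] by linarith
          show "(f x i - s c) * q < real_of_int (a i) + 1" unfolding ai by linarith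
        qed
        moreover have "a \<in> A"
          unfolding A_def a_def
        proof (rule restrict_PiE_iff[THEN iffD2], intro ballI)
          fix i assume "i \<in> I"
          have b: "0 < s c * q" "s c * q < 1"
            using sb[OF c(1)] order_less_le_trans[of "s c * q" "1 / (m + 1)" 1] by simp_all
          have "f x i * q \<le> 1 * real q" using f1 by (intro mult_right_mono) auto
          then have 1: "(f x i - s c) * q < q + 1" using b by (simp add: algebra_simps)
          have "0 \<le> f x i * q" using f0 by simp
          then have "-1 \<le> (f x i - s c) * q" using b by (simp add: algebra_simps)
          with 1 show "\<lfloor>(f x i - s c) * q\<rfloor> \<in> {-1..int q}"
            by (auto simp: le_floor_iff floor_le_iff)
        qed
        ultimately show False using c by (auto simp: \<U>_def)
      qed
    qed
    have "card {c. c < N \<and> (\<exists>i. (f x i - s c) * q \<in> \<int>)} \<le> m"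
      using sb by (intro card_nonintegral_colours[OF fin\<sigma> c\<sigma> s1 _ _ sinj]) (simp_all add: \<sigma>_def)
    moreover have "finite {c. c < N \<and> (\<exists>i. (f x i - s c) * q \<in> \<int>)}" by simp
    ultimately show ?thesis using card_mono[OF _ sub] by linarith
  qed
  show ?thesis
    using dis op close bad finA by (intro exI[of _ \<U>]) (auto simp: coloured_family_def \<U>_def)
qed

text \<open>Among m + n + 1 colours at most m miss a point in the first system and at most n in the
  second, so some colour catches it in both. Intersecting sets of the same colour therefore covers,
  and since each colour holds a point at most once, the order is at most the number of
  colours.\<close>

lemma coloured_families_imp_fine_cover:
  fixes P Q R :: "'a::topological_space \<Rightarrow> 'a \<Rightarrow> bool"
  assumes "coloured_family P m (m + n + 1) \<U>" "coloured_family Q n (m + n + 1) \<V>"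
    and R: "\<And>x y. P x y \<Longrightarrow> Q x y \<Longrightarrow> R x y"
  shows "\<exists>\<W>. fine_cover R (m + n) \<W>"
proof -
  define N where "N = m + n + 1"
  define F where "F c = (\<lambda>(U,V). U \<inter> V) ` (\<U> c \<times> \<V> c)" for c
  define \<W> where "\<W> = (\<Union>c<N. F c)"
  have U: "finite (\<U> c)" "disjoint (\<U> c)" "\<And>U. U \<in> \<U> c \<Longrightarrow> open U"
    "\<And>U x y. U \<in> \<U> c \<Longrightarrow> x \<in> U \<Longrightarrow> y \<in> U \<Longrightarrow> P x y"
    and V: "finite (\<V> c)" "disjoint (\<V> c)" "\<And>U. U \<in> \<V> c \<Longrightarrow> open U"
    "\<And>U x y. U \<in> \<V> c \<Longrightarrow> x \<in> U \<Longrightarrow> y \<in> U \<Longrightarrow> Q x y" for c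
    using assms(1,2) by (auto simp: coloured_family_def)
  have one: "W = W'" if W: "W \<in> F c" "W' \<in> F c" and x: "x \<in> W" "x \<in> W'" for W W' c x
  proof -
    obtain A B A' B' where AB: "A \<in> \<U> c" "B \<in> \<V> c" "W = A \<inter> B"
      "A' \<in> \<U> c" "B' \<in> \<V> c" "W' = A' \<inter> B'"
      using W unfolding F_def by blast
    have "A = A'" using disjointD[OF U(2)[of c] AB(1,4)] x AB(3,6) by blast
    moreover have "B = B'" using disjointD[OF V(2)[of c] AB(2,5)] x AB(3,6) by blast
    ultimately show ?thesis using AB by simp
  qed
  have fin: "finite \<W>" using U(1) V(1) by (auto simp: \<W>_def F_def)
  have cov: "\<exists>W\<in>\<W>. x \<in> W" for x
  proof -
    let ?A = "{c. c < N \<and> x \<notin> \<Union>(\<U> c)}" and ?B = "{c. c < N \<and> x \<notin> \<Union>(\<V> c)}"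
    have "card (?A \<union> ?B) \<le> card ?A + card ?B" by (rule card_Un_le)
    also have "\<dots> \<le> m + n"
      by (rule add_mono) (use assms(1,2) in \<open>simp_all only: coloured_family_def N_def\<close>)
    also have "\<dots> < card {..<N}" by (simp add: N_def)
    finally have "\<not> {..<N} \<subseteq> ?A \<union> ?B" using card_mono[of "?A \<union> ?B" "{..<N}"] by auto
    then show ?thesis by (fastforce simp: \<W>_def F_def)
  qed
  have ord: "card {W\<in>\<W>. x \<in> W} \<le> m + n + 1" for x
  proof -
    have "{W\<in>\<W>. x \<in> W} \<subseteq> (\<lambda>c. THE W. W \<in> F c \<and> x \<in> W) ` {..<N}"
    proof safe
      fix W assume "W \<in> \<W>" "x \<in> W"
      then obtain c where c: "c < N" "W \<in> F c" by (auto simp: \<W>_def)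
      have "W = (THE W. W \<in> F c \<and> x \<in> W)"
        by (rule the_equality[symmetric]) (use c \<open>x \<in> W\<close> one in blast)+
      then show "W \<in> (\<lambda>c. THE W. W \<in> F c \<and> x \<in> W) ` {..<N}"
        by (rule image_eqI) (use c in simp)
    qed
    then have "card {W\<in>\<W>. x \<in> W} \<le> card {..<N}" by (rule surj_card_le[rotated]) simp
    then show ?thesis by (simp add: N_def)
  qed
  have "fine_cover R (m + n) \<W>"
    unfolding fine_cover_def
  proof (intro conjI ballI allI)
    show "\<Union>\<W> = UNIV" using cov by auto
    show "open W" if "W \<in> \<W>" for W using that U(3) V(3) by (auto simp: \<W>_def F_def)
    show "R x y" if W: "W \<in> \<W>" and x: "x \<in> W" "y \<in> W" for W x y
    proof -
      obtain c A B where "A \<in> \<U> c" "B \<in> \<V> c" "W = A \<inter> B"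
        using W unfolding \<W>_def F_def by blast
      then show ?thesis using x by (intro R U(4)[of A c] V(4)[of B c]) auto
    qed
  qed (use fin ord in auto)
  then show ?thesis by blast
qed

text \<open>Normalised distances to the complements. Each function is nonzero exactly on its set,
  not merely supported there, so that the values of the partition reveal which sets contain a
  point.\<close>

lemma open_cover_partition_of_unity:
  fixes \<V> :: "'a::metric_space set set"
  assumes "finite \<V>" "\<And>V. V \<in> \<V> \<Longrightarrow> open V" "\<Union>\<V> = UNIV"
  obtains t :: "'a set \<Rightarrow> 'a \<Rightarrow> real" where
    "\<And>V. V \<in> \<V> \<Longrightarrow> continuous_on UNIV (t V)"
    "\<And>V x. V \<in> \<V> \<Longrightarrow> 0 \<le> t V x" "\<And>V x. V \<in> \<V> \<Longrightarrow> t V x \<noteq> 0 \<longleftrightarrow> x \<in> V"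
    "\<And>x. (\<Sum>V\<in>\<V>. t V x) = 1"
proof -
  \<comment> \<open>The distance to an empty complement is 0 by convention, hence the separate value
    for the whole space.\<close>
  define \<phi> where "\<phi> V x = (if V = UNIV then 1 else infdist x (- V))" for V and x :: 'a
  have cont: "continuous_on UNIV (\<phi> V)" for V
    unfolding \<phi>_def by (cases "V = UNIV") (auto intro: continuous_intros)
  have nn: "0 \<le> \<phi> V x" for V x by (auto simp: \<phi>_def infdist_nonneg)
  have pos: "\<phi> V x \<noteq> 0 \<longleftrightarrow> x \<in> V" if "V \<in> \<V>" for V x
  proof -
    have "closed (- V)" using assms(2)[OF that] by auto
    then show ?thesis using in_closed_iff_infdist_zero[of "- V" x] by (auto simp: \<phi>_def)
  qed
  have S: "(\<Sum>V\<in>\<V>. \<phi> V x) > 0" for x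
  proof -
    have "x \<in> \<Union>\<V>" using assms(3) by simp
    then obtain V where V: "V \<in> \<V>" "x \<in> V" by blast
    have "0 < \<phi> V x" using pos[OF V(1), of x] nn[of V x] V(2) by simp
    then show ?thesis by (rule sum_pos2[OF assms(1) V(1)]) (rule nn)
  qed
  show thesis
  proof (rule that[of "\<lambda>V x. \<phi> V x / (\<Sum>V\<in>\<V>. \<phi> V x)"])
    show "continuous_on UNIV (\<lambda>x. \<phi> V x / (\<Sum>V\<in>\<V>. \<phi> V x))" for V
      using S by (intro continuous_intros cont) (simp add: less_imp_neq[symmetric])
    show "0 \<le> \<phi> V x / (\<Sum>V\<in>\<V>. \<phi> V x)" for V x using nn S by (simp add: sum_nonneg)
    show "(\<phi> V x / (\<Sum>V\<in>\<V>. \<phi> V x) \<noteq> 0) = (x \<in> V)" if "V \<in> \<V>" for V x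
      using pos[OF that] S[of x] by auto
    show "(\<Sum>V\<in>\<V>. \<phi> V x / (\<Sum>V\<in>\<V>. \<phi> V x)) = 1" for x
      using S[of x] by (simp flip: sum_divide_distrib)
  qed
qed

text \<open>The canonical map to the nerve \<open>K\<close> of the cover, with vertices renumbered
  by \<open>e\<close>: points with equal barycentric coordinates share a vertex of positive weight,
  whose set contains both.\<close>

lemma fine_cover_imp_fine_map:
  fixes P :: "'a::metric_space \<Rightarrow> 'a \<Rightarrow> bool"
  assumes "fine_cover P m \<V>"
  shows "fine_map P m"
proof -
  have fin: "finite \<V>" and op: "\<And>V. V \<in> \<V> \<Longrightarrow> open V" and cov: "\<Union>\<V> = UNIV"
    and P: "\<And>V x y. V \<in> \<V> \<Longrightarrow> x \<in> V \<Longrightarrow> y \<in> V \<Longrightarrow> P x y"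
    and ord: "\<And>x. card {V\<in>\<V>. x \<in> V} \<le> m + 1"
    using assms by (auto simp: fine_cover_def)
  obtain t where t: "\<And>V. V \<in> \<V> \<Longrightarrow> continuous_on UNIV (t V)"
    "\<And>V x. V \<in> \<V> \<Longrightarrow> 0 \<le> t V x" "\<And>V x. V \<in> \<V> \<Longrightarrow> t V x \<noteq> 0 \<longleftrightarrow> x \<in> V"
    "\<And>x. (\<Sum>V\<in>\<V>. t V x) = (1::real)"
    using open_cover_partition_of_unity[OF fin op cov] by blast
  obtain e where e: "bij_betw e {..<card \<V>} \<V>"
    using ex_bij_betw_nat_finite[OF fin] by (auto simp: lessThan_atLeast0)
  define L where "L = card \<V>"
  have eV: "e i \<in> \<V>" if "i < L" for i using e that by (auto simp: bij_betw_def L_def)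
  define K where "K = {\<sigma>. \<sigma> \<noteq> {} \<and> \<sigma> \<subseteq> {..<L} \<and> (\<exists>x. \<forall>i\<in>\<sigma>. x \<in> e i)}"
  define f where "f x i = (if i < L then t (e i) x else 0)" for x i
  have supp: "{i. f x i \<noteq> 0} = {i. i < L \<and> x \<in> e i}" for x
  proof (rule Collect_cong)
    show "f x i \<noteq> 0 \<longleftrightarrow> i < L \<and> x \<in> e i" for i
      using t(3)[OF eV, of i x] by (auto simp: f_def)
  qed
  have sub: "K \<subseteq> Pow {..<L}" by (auto simp: K_def)
  have K1: "fin_simplicial_complex K"
    unfolding fin_simplicial_complex_def
  proof (intro conjI ballI allI impI)
    show "finite K" using finite_subset[OF sub] by simp
  qed (auto simp: K_def intro: finite_subset[of _ "{..<L}"])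
  have K2: "complex_dim_le K m"
    unfolding complex_dim_le_def
  proof
    fix \<sigma> assume "\<sigma> \<in> K"
    then obtain x where x: "\<sigma> \<subseteq> {..<L}" "\<forall>i\<in>\<sigma>. x \<in> e i" by (auto simp: K_def)
    have "inj_on e \<sigma>" using e x(1) by (auto simp: bij_betw_def L_def intro: inj_on_subset)
    moreover have "e ` \<sigma> \<subseteq> {V\<in>\<V>. x \<in> V}" using x eV by auto
    ultimately have "card \<sigma> \<le> card {V\<in>\<V>. x \<in> V}" using fin by (intro card_inj_on_le) auto
    then show "card \<sigma> \<le> m + 1" using ord[of x] by linarith
  qed
  have sum1: "(\<Sum>i<L. f x i) = 1" for x
    using sum.reindex_bij_betw[OF e, of "\<lambda>V. t V x"] t(4)[of x] by (simp add: f_def L_def)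
  have geom: "f x \<in> geom_real K" for x
    unfolding geom_real_def
  proof (intro CollectI conjI allI)
    show "0 \<le> f x i" for i using t(2) eV by (auto simp: f_def)
    show s1: "(\<Sum>i\<in>{i. f x i \<noteq> 0}. f x i) = 1"
      by (subst sum1[of x, symmetric], rule sum.mono_neutral_left) (auto simp: f_def split: if_splits)
    then have "{i. f x i \<noteq> 0} \<noteq> {}" by force
    then show "{i. f x i \<noteq> 0} \<in> K" unfolding supp by (auto simp: K_def)
  qed
  have cont: "continuous_map euclidean (geom_top K) f"
    unfolding geom_top_def continuous_map_in_subtopology continuous_map_componentwise_UNIV
  proof (intro conjI allI)
    show "continuous_map euclidean euclidean (\<lambda>x. f x i)" for i
      using t(1)[OF eV] by (cases "i < L") (auto simp: f_def)
  qed (use geom in auto)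
  have inj: "P x y" if "f x = f y" for x y
  proof -
    have "{i. f x i \<noteq> 0} \<noteq> {}" using geom[of x] by (force simp: geom_real_def)
    then obtain i where "i \<in> {i. f x i \<noteq> 0}" by auto
    moreover then have "i \<in> {i. f y i \<noteq> 0}" using that by simp
    ultimately show ?thesis using P eV unfolding supp by blast
  qed
  show ?thesis unfolding fine_map_def using K1 K2 cont inj by blast
qed

section \<open>Subadditivity of widim\<close>

text \<open>For a finite nonempty window this is the Bowen metric being below
  \<open>\<epsilon>\<close>. Unlike a supremum it is also meaningful for the empty window, where it
  holds trivially and starts inductions on windows.\<close>

definition orbit_close :: "(int^'k \<Rightarrow> 'a::metric_space \<Rightarrow> 'a) \<Rightarrow> (int^'k) set \<Rightarrow> real \<Rightarrow> 'a \<Rightarrow> 'a \<Rightarrow> bool" where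
  "orbit_close T \<Omega> \<epsilon> x y \<longleftrightarrow> (\<forall>n\<in>\<Omega>. dist (T n x) (T n y) < \<epsilon>)"

lemma orbit_close_subset: "orbit_close T \<Omega>' \<epsilon> x y \<Longrightarrow> \<Omega> \<subseteq> \<Omega>' \<Longrightarrow> orbit_close T \<Omega> \<epsilon> x y"
  by (auto simp: orbit_close_def)

lemma zk_action_cont: "zk_action T \<Longrightarrow> continuous_on A (T n)"
  unfolding zk_action_def by (auto intro: continuous_on_subset)

lemma zk_action_comp:
  assumes "zk_action T" shows "T m (T n x) = T (m + n) x"
  using assms by (simp add: zk_action_def)

lemma zk_action_0:
  assumes "zk_action T" shows "T 0 x = x"
  using assms by (simp add: zk_action_def)

lemma open_orbit_close:
  assumes "zk_action T" "finite \<Omega>"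
  shows "open {p. orbit_close T \<Omega> \<epsilon> (fst p) (snd p)}"
proof -
  have "{p. orbit_close T \<Omega> \<epsilon> (fst p) (snd p)} = (\<Inter>n\<in>\<Omega>. {p. dist (T n (fst p)) (T n (snd p)) < \<epsilon>})"
    by (auto simp: orbit_close_def)
  also have "open \<dots>"
    using assms(2)
    by (intro open_INT ballI open_Collect_less continuous_intros
        continuous_on_compose2[OF zk_action_cont[OF assms(1)]]) auto
  finally show ?thesis .
qed

lemma dOmega_less_iff:
  assumes "finite \<Omega>" "\<Omega> \<noteq> {}"
  shows "dOmega T \<Omega> x y < \<epsilon> \<longleftrightarrow> orbit_close T \<Omega> \<epsilon> x y"
proof -
  have "dOmega T \<Omega> x y = Max ((\<lambda>n. dist (T n x) (T n y)) ` \<Omega>)"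
    unfolding dOmega_def using assms by (intro cSup_eq_Max) auto
  then show ?thesis using assms by (auto simp: orbit_close_def)
qed

lemma continuous_dOmega:
  assumes "zk_action T" "finite \<Omega>" "\<Omega> \<noteq> {}"
  shows "continuous_on UNIV (\<lambda>p. dOmega T \<Omega> (fst p) (snd p))"
proof -
  have eq: "(\<lambda>p. dOmega T \<Omega> (fst p) (snd p)) = (\<lambda>p. Max ((\<lambda>n. dist (T n (fst p)) (T n (snd p))) ` \<Omega>))"
    unfolding dOmega_def using assms by (intro ext cSup_eq_Max) auto
  show ?thesis
    unfolding eq     using assms(2,3)
  proof (induction rule: finite_ne_induct)
    case (singleton n)
    then show ?case
      by (auto intro!: continuous_intros continuous_on_compose2[OF zk_action_cont[OF assms(1)]])
  next
    case (insert n F)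
    have "(\<lambda>p. Max ((\<lambda>n. dist (T n (fst p)) (T n (snd p))) ` insert n F))
      = (\<lambda>p. max (dist (T n (fst p)) (T n (snd p))) (Max ((\<lambda>n. dist (T n (fst p)) (T n (snd p))) ` F)))"
      using insert by simp
    then show ?case using insert
      by (auto intro!: continuous_intros continuous_on_compose2[OF zk_action_cont[OF assms(1)]])
  qed
qed

text \<open>The fibres of \<open>f\<close> are closed, hence compact, so their diameters are
  attained and a strict bound on all pairs passes to the supremum. Empty fibres have diameter 0 by
  definition.\<close>

lemma eps_embedding_iff:
  assumes "compact (UNIV :: 'a::metric_space set)" "zk_action T" "finite \<Omega>" "\<Omega> \<noteq> {}" "\<epsilon> > 0"
  shows "eps_embedding (dOmega T \<Omega> :: 'a \<Rightarrow> 'a \<Rightarrow> real) \<epsilon> K f \<longleftrightarrow>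
    continuous_map euclidean (geom_top K) f \<and> (\<forall>x y. f x = f y \<longrightarrow> orbit_close T \<Omega> \<epsilon> x y)"
proof -
  define d where "d = dOmega T \<Omega>"
  have dcont: "continuous_on A (\<lambda>p. d (fst p) (snd p))" for A
    using continuous_dOmega[OF assms(2-4)] continuous_on_subset unfolding d_def by blast
  have "(\<forall>y. diam_wrt d (f -` {y}) < \<epsilon>) \<longleftrightarrow> (\<forall>x y. f x = f y \<longrightarrow> d x y < \<epsilon>)"
    if cont: "continuous_map euclidean (geom_top K) f"
  proof -
    have fcont: "continuous_on UNIV (\<lambda>x. f x i)" for i
      using cont by (auto simp: geom_top_def continuous_map_in_subtopology continuous_map_componentwise_UNIV)
    have comp: "compact (f -` {y} \<times> f -` {y})" for y
    proof -
      have "f -` {y} = (\<Inter>i. {x. f x i = y i})" by auto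
      moreover have "closed (\<Inter>i. {x. f x i = y i})"
        by (intro closed_INT ballI closed_Collect_eq fcont continuous_intros)
      ultimately have "compact (f -` {y})" using compact_Int_closed[OF assms(1)] by auto
      then show ?thesis by (intro compact_Times)
    qed
    have bdd: "bdd_above ((\<lambda>p. d (fst p) (snd p)) ` (f -` {y} \<times> f -` {y}))" for y
      by (rule bounded_imp_bdd_above[OF compact_imp_bounded[OF compact_continuous_image[OF dcont comp]]])
    show ?thesis
    proof (intro iffI allI impI)
      fix x y assume *: "\<forall>y. diam_wrt d (f -` {y}) < \<epsilon>" "f x = f y"
      have "d x y \<le> diam_wrt d (f -` {f y})"
        unfolding diam_wrt_def
        using cSUP_upper[OF _ bdd, of "(x,y)" "f y"] *(2) by auto
      also have "\<dots> < \<epsilon>" using *(1) by blast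
      finally show "d x y < \<epsilon>" .
    next
      fix y assume *: "\<forall>x y. f x = f y \<longrightarrow> d x y < \<epsilon>"
      show "diam_wrt d (f -` {y}) < \<epsilon>"
      proof (cases "f -` {y} = {}")
        case False
        then have ne: "f -` {y} \<times> f -` {y} \<noteq> {}" by simp
        obtain p where p: "p \<in> f -` {y} \<times> f -` {y}"
          "\<And>q. q \<in> f -` {y} \<times> f -` {y} \<Longrightarrow> d (fst q) (snd q) \<le> d (fst p) (snd p)"
          using continuous_attains_sup[OF comp ne dcont] by blast
        have "diam_wrt d (f -` {y}) \<le> d (fst p) (snd p)"
          unfolding diam_wrt_def if_not_P[OF False]
          by (rule cSUP_least) (use False p(2) in blast)+
        also have "\<dots> < \<epsilon>" using p(1) *[rule_format, of "fst p" "snd p"] by auto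
        finally show ?thesis .
      qed (use assms in \<open>auto simp: diam_wrt_def\<close>)
    qed
  qed
  then show ?thesis
    using dOmega_less_iff[OF assms(3,4), of T] unfolding eps_embedding_def d_def by auto
qed

lemma widim_eq:
  assumes "compact (UNIV :: 'a::metric_space set)" "zk_action T" "finite \<Omega>" "\<Omega> \<noteq> {}" "\<epsilon> > 0"
  shows "widim (dOmega T \<Omega> :: 'a \<Rightarrow> 'a \<Rightarrow> real) \<epsilon> = (LEAST m. fine_map (orbit_close T \<Omega> \<epsilon>) m)"
  unfolding widim_def fine_map_def eps_embedding_iff[OF assms] by (rule refl)

text \<open>A finite subcover by half-size neighbourhoods, with its cardinality as a crude order
  bound. It ensures that the \<open>LEAST\<close> in \<open>widim\<close> is taken over a nonempty
  set.\<close>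

lemma fine_map_exists:
  assumes "compact (UNIV :: 'a::metric_space set)" "zk_action T" "finite \<Omega>" "\<epsilon> > 0"
  shows "\<exists>m. fine_map (orbit_close T \<Omega> \<epsilon> :: 'a \<Rightarrow> 'a \<Rightarrow> bool) m"
proof -
  define V where "V x = {y. \<forall>n\<in>\<Omega>. dist (T n y) (T n x) < \<epsilon> / 2}" for x :: 'a
  have "open (V x)" for x
  proof -
    have "V x = (\<Inter>n\<in>\<Omega>. {y. dist (T n y) (T n x) < \<epsilon> / 2})" by (auto simp: V_def)
    also have "open \<dots>" using assms(3)
      by (intro open_INT ballI open_Collect_less continuous_intros zk_action_cont[OF assms(2)]) auto
    finally show ?thesis .
  qed
  moreover have "UNIV \<subseteq> (\<Union>x. V x)" using assms by (auto simp: V_def)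
  ultimately obtain C where C: "finite C" "UNIV \<subseteq> (\<Union>x\<in>C. V x)"
    using compactE_image[OF assms(1), of UNIV V] by auto
  have "fine_cover (orbit_close T \<Omega> \<epsilon>) (card (V ` C)) (V ` C)"
    unfolding fine_cover_def
  proof (intro conjI ballI allI)
    fix U x y assume "U \<in> V ` C" "x \<in> U" "y \<in> U"
    then obtain z where "x \<in> V z" "y \<in> V z" by auto
    then show "orbit_close T \<Omega> \<epsilon> x y"
      unfolding V_def orbit_close_def using dist_triangle_half_l by blast
  next
    fix x show "card {U \<in> V ` C. x \<in> U} \<le> card (V ` C) + 1"
      using card_mono[of "V ` C" "{U \<in> V ` C. x \<in> U}"] C by auto
  qed (use C \<open>\<And>x. open (V x)\<close> in auto)
  then show ?thesis using fine_cover_imp_fine_map by blast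
qed

lemma fine_map_widim:
  assumes "compact (UNIV :: 'a::metric_space set)" "zk_action T" "finite \<Omega>" "\<Omega> \<noteq> {}" "\<epsilon> > 0"
  shows "fine_map (orbit_close T \<Omega> \<epsilon>) (widim (dOmega T \<Omega> :: 'a \<Rightarrow> 'a \<Rightarrow> real) \<epsilon>)"
  unfolding widim_eq[OF assms] using fine_map_exists[OF assms(1-3,5)] by (rule LeastI_ex)

lemma widim_le:
  assumes "compact (UNIV :: 'a::metric_space set)" "zk_action T" "finite \<Omega>" "\<Omega> \<noteq> {}" "\<epsilon> > 0"
    and "fine_map (orbit_close T \<Omega> \<epsilon> :: 'a \<Rightarrow> 'a \<Rightarrow> bool) m"
  shows "widim (dOmega T \<Omega> :: 'a \<Rightarrow> 'a \<Rightarrow> real) \<epsilon> \<le> m"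
  unfolding widim_eq[OF assms(1-5)] using assms(6) by (rule Least_le)

lemma fine_map_mono:
  assumes "fine_map P m" "\<And>x y. P x y \<Longrightarrow> Q x y"
  shows "fine_map Q m"
  using assms unfolding fine_map_def by blast

text \<open>Dimensions add, as for the diagonal map into a product of two polyhedra. Both relations
  are coloured with m + n + 1 colours, the least number that guarantees a common colour at every
  point.\<close>

lemma fine_map_conj:
  fixes P Q :: "'a::metric_space \<Rightarrow> 'a \<Rightarrow> bool"
  assumes "compact (UNIV :: 'a set)"
    and "open {p. P (fst p) (snd p)}" "fine_map P m"
    and "open {p. Q (fst p) (snd p)}" "fine_map Q n"
  shows "\<exists>\<W>. fine_cover (\<lambda>x y. P x y \<and> Q x y) (m + n) \<W>"
proof -
  obtain \<U> \<V> where "coloured_family P m (m + n + 1) \<U>" "coloured_family Q n (m + n + 1) \<V>"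
    using fine_map_imp_coloured_family[OF assms(1-3)] fine_map_imp_coloured_family[OF assms(1,4,5)]
    by blast
  then show ?thesis by (rule coloured_families_imp_fine_cover) auto
qed

lemma fine_map_shift:
  assumes "zk_action T" "fine_map (orbit_close T \<Omega> \<epsilon>) m"
  shows "fine_map (orbit_close T ((\<lambda>n. n + a) ` \<Omega>) \<epsilon>) m"
proof -
  obtain K f where K: "fin_simplicial_complex K" "complex_dim_le K m"
    and f: "continuous_map euclidean (geom_top K) f" "\<And>x y. f x = f y \<Longrightarrow> orbit_close T \<Omega> \<epsilon> x y"
    using assms(2) by (auto simp: fine_map_def)
  have "continuous_map euclidean euclidean (T a)" using zk_action_cont[OF assms(1)] by simp
  then have "continuous_map euclidean (geom_top K) (f \<circ> T a)" using f(1) continuous_map_compose by blast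
  moreover have "orbit_close T ((\<lambda>n. n + a) ` \<Omega>) \<epsilon> x y" if "(f \<circ> T a) x = (f \<circ> T a) y" for x y
    using f(2)[of "T a x" "T a y"] that by (simp add: orbit_close_def zk_action_comp[OF assms(1)])
  ultimately show ?thesis using K unfolding fine_map_def by blast
qed

text \<open>Subadditivity in the form used twice below: for a large box, giving the limit in
  \<open>mdim\<close>, and for irregular Voronoi cells covered by boxes. The translates may
  overlap.\<close>

lemma fine_map_Union_shifts:
  fixes T :: "int^'k \<Rightarrow> 'a::metric_space \<Rightarrow> 'a"
  assumes "compact (UNIV :: 'a set)" "zk_action T" "finite \<Omega>" "fine_map (orbit_close T \<Omega> \<epsilon>) m" "finite A"
  shows "fine_map (orbit_close T (\<Union>a\<in>A. (\<lambda>n. n + a) ` \<Omega>) \<epsilon>) (card A * m)"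
  using assms(5)
proof (induction A rule: finite_induct)
  case empty
  have "fine_cover (orbit_close T {} \<epsilon> :: 'a \<Rightarrow> 'a \<Rightarrow> bool) 0 {UNIV}"
    by (auto simp: fine_cover_def orbit_close_def intro: order_trans[OF card_mono[of "{UNIV}"]])
  then show ?case using fine_cover_imp_fine_map by simp
next
  case (insert a A)
  let ?S = "\<lambda>a. (\<lambda>n. n + a) ` \<Omega>"
  have "\<exists>\<W>. fine_cover (\<lambda>x y. orbit_close T (?S a) \<epsilon> x y \<and> orbit_close T (\<Union>a\<in>A. ?S a) \<epsilon> x y) (m + card A * m) \<W>"
    using insert assms fine_map_shift[OF assms(2,4)]
    by (intro fine_map_conj open_orbit_close) auto
  then have "fine_map (\<lambda>x y. orbit_close T (?S a) \<epsilon> x y \<and> orbit_close T (\<Union>a\<in>A. ?S a) \<epsilon> x y) (m + card A * m)"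
    using fine_cover_imp_fine_map by blast
  then have "fine_map (orbit_close T (\<Union>a\<in>insert a A. ?S a) \<epsilon>) (m + card A * m)"
    by (rule fine_map_mono) (unfold orbit_close_def, blast)
  moreover have eq: "card (insert a A) * m = m + card A * m" using insert(1,2) by simp
  ultimately show ?case unfolding eq by blast
qed

section \<open>Boxes in the lattice and the limits that define mean dimension\<close>

lemma finite_vec_set: "finite {v :: 'b^'k. \<forall>i. v $ i \<in> A}" if "finite A"
proof (rule finite_imageD)
  show "finite (vec_nth ` {v :: 'b^'k. \<forall>i. v $ i \<in> A})"
    by (rule finite_subset[OF _ finite_PiE[of "UNIV :: 'k set" "\<lambda>_. A"]]) (use that in auto)
  show "inj_on vec_nth {v :: 'b^'k. \<forall>i. v $ i \<in> A}"
    by (rule inj_onI) (simp add: vec_nth_inject)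
qed

lemma card_vec_set: "card {v :: 'b^'k. \<forall>i. v $ i \<in> A} = card A ^ CARD('k)"
proof -
  have "bij_betw vec_nth {v :: 'b^'k. \<forall>i. v $ i \<in> A} (PiE (UNIV :: 'k set) (\<lambda>_. A))"
    by (rule bij_betw_byWitness[where f' = vec_lambda]) (auto simp: PiE_iff)
  from bij_betw_same_card[OF this] show ?thesis by (simp add: card_PiE)
qed

lemma finite_box: "finite (Defs.box N)"
  by (rule finite_subset[OF _ finite_vec_set[of "{0..<int N}"]]) (auto simp: Defs.box_def)

lemma card_box: "card (Defs.box N :: (int^'k) set) = N ^ CARD('k)"
  using card_vec_set[of "{0..<int N}"] by (simp add: Defs.box_def)

lemma box_nonempty: "N \<ge> 1 \<Longrightarrow> 0 \<in> Defs.box N"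
  by (simp add: Defs.box_def)

text \<open>Coordinatewise division with remainder; the extra 1 allows for an incomplete last
  translate.\<close>

lemma box_subset_shifts:
  assumes "N \<ge> 1"
  shows "(Defs.box M :: (int^'k) set) \<subseteq>
    (\<Union>a\<in>(\<lambda>b. \<chi> i. int N * b $ i) ` Defs.box (M div N + 1). (\<lambda>n. n + a) ` Defs.box N)"
proof
  fix n :: "int^'k" assume n: "n \<in> Defs.box M"
  define b :: "int^'k" where "b = (\<chi> i. n $ i div int N)"
  define r :: "int^'k" where "r = (\<chi> i. n $ i mod int N)"
  have "b \<in> Defs.box (M div N + 1)"
    unfolding Defs.box_def b_def
  proof (intro CollectI allI conjI)
    fix i
    have n: "0 \<le> n $ i" "n $ i \<le> int M" using n by (auto simp: Defs.box_def less_imp_le)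
    show "0 \<le> (\<chi> i. n $ i div int N) $ i" using n assms by (simp add: pos_imp_zdiv_nonneg_iff)
    have "n $ i div int N \<le> int M div int N" using n assms by (intro zdiv_mono1) auto
    then show "(\<chi> i. n $ i div int N) $ i < int (M div N + 1)" by (simp add: zdiv_int)
  qed
  moreover have "r \<in> Defs.box N" using assms by (auto simp: Defs.box_def r_def)
  moreover have "n = r + (\<chi> i. int N * b $ i)" by (simp add: vec_eq_iff b_def r_def)
  ultimately show "n \<in> (\<Union>a\<in>(\<lambda>b. \<chi> i. int N * b $ i) ` Defs.box (M div N + 1). (\<lambda>n. n + a) ` Defs.box N)"
    by blast
qed

lemma widim_box_le:
  fixes T :: "int^'k \<Rightarrow> 'a::metric_space \<Rightarrow> 'a"
  assumes "compact (UNIV :: 'a set)" "zk_action T" "\<epsilon> > 0" "N \<ge> 1" "M \<ge> 1"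
  shows "widim (dOmega T (Defs.box M)) \<epsilon> \<le> (M div N + 1) ^ CARD('k) * widim (dOmega T (Defs.box N)) \<epsilon>"
proof (rule widim_le)
  define A :: "(int^'k) set" where "A = (\<lambda>b. \<chi> i. int N * b $ i) ` Defs.box (M div N + 1)"
  have "inj_on (\<lambda>b :: int^'k. \<chi> i. int N * b $ i) X" for X
    using assms by (auto simp: inj_on_def vec_eq_iff)
  then have cA: "card A = (M div N + 1) ^ CARD('k)"
    unfolding A_def by (simp add: card_image card_box)
  have sub: "Defs.box M \<subseteq> (\<Union>a\<in>A. (\<lambda>n. n + a) ` Defs.box N)"
    unfolding A_def by (rule box_subset_shifts[OF assms(4)])
  have "fine_map (orbit_close T (\<Union>a\<in>A. (\<lambda>n. n + a) ` Defs.box N) \<epsilon>) (card A * widim (dOmega T (Defs.box N)) \<epsilon>)"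
  proof (intro fine_map_Union_shifts fine_map_widim)
    show "Defs.box N \<noteq> ({} :: (int^'k) set)" using box_nonempty[OF assms(4)] by blast
    show "finite A" by (simp add: A_def finite_box)
  qed (rule assms finite_box)+
  then show "fine_map (orbit_close T (Defs.box M) \<epsilon>) ((M div N + 1) ^ CARD('k) * widim (dOmega T (Defs.box N)) \<epsilon>)"
    unfolding cA
    by (rule fine_map_mono) (rule orbit_close_subset[OF _ sub])
  show "Defs.box M \<noteq> ({} :: (int^'k) set)" using box_nonempty[OF assms(5)] by blast
  show "zk_action T" "\<epsilon> > 0" "compact (UNIV :: 'a set)" by fact+
  show "finite (Defs.box M :: (int^'k) set)" by (rule finite_box)
qed

text \<open>Dividing the hypothesis by M^k gives a(M) / M^k \<le> (1/N + 1/M)^k a(N), whose right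
  side tends to a(N) / N^k. So the limit superior is at most each such quotient, hence at most their
  infimum, which trivially bounds from below.\<close>

lemma Fekete_power:
  fixes a :: "nat \<Rightarrow> nat"
  assumes sub: "\<And>M N. M \<ge> 1 \<Longrightarrow> N \<ge> 1 \<Longrightarrow> a M \<le> (M div N + 1) ^ k * a N"
  shows "(\<lambda>N. real (a N) / real N ^ k) \<longlonglongrightarrow> (INF N\<in>{1..}. real (a N) / real N ^ k)"
proof (rule order_tendstoI)
  define L where "L = (INF N\<in>{1..}. real (a N) / real N ^ k)"
  have bdd: "bdd_below ((\<lambda>N. real (a N) / real N ^ k) ` {1..})"
    by (rule bdd_belowI[of _ 0]) auto
  have low: "L \<le> real (a N) / real N ^ k" if "N \<ge> 1" for N
    unfolding L_def by (rule cINF_lower[OF bdd]) (use that in auto)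
  fix u assume "u < L"
  then show "\<forall>\<^sub>F N in sequentially. u < real (a N) / real N ^ k"
    using low by (intro eventually_sequentiallyI[of 1]) (auto intro: less_le_trans)
next
  fix u assume "(INF N\<in>{1..}. real (a N) / real N ^ k) < u"
  then obtain N :: nat where N: "N \<ge> 1" "real (a N) / real N ^ k < u"
    using cInf_lessD[of "(\<lambda>N. real (a N) / real N ^ k) ` {1::nat..}" u] by auto
  have "(\<lambda>M. (1 / real N + 1 / real M) ^ k * real (a N)) \<longlonglongrightarrow> (1 / real N + 0) ^ k * real (a N)"
    by (intro tendsto_intros lim_1_over_n)
  moreover have "(1 / real N + 0) ^ k * real (a N) < u" using N by (simp add: power_divide)
  ultimately have "\<forall>\<^sub>F M in sequentially. (1 / real N + 1 / real M) ^ k * real (a N) < u"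
    by (rule order_tendstoD)
  then show "\<forall>\<^sub>F M in sequentially. real (a M) / real M ^ k < u"
    using eventually_ge_at_top[of 1]
  proof eventually_elim
    case (elim M)
    have "real (a M) \<le> real ((M div N + 1) ^ k * a N)" using sub[of M N] elim N of_nat_le_iff by blast
    also have "\<dots> = (real (M div N) + 1) ^ k * real (a N)" by (simp add: add.commute)
    also have "\<dots> \<le> (real M / real N + 1) ^ k * real (a N)"
      by (intro mult_right_mono power_mono add_mono of_nat_div_le_of_nat) auto
    finally have "real (a M) / real M ^ k \<le> (real M / real N + 1) ^ k * real (a N) / real M ^ k"
      by (simp add: divide_right_mono)
    also have "\<dots> = ((real M / real N + 1) / real M) ^ k * real (a N)" by (simp add: power_divide)
    also have "(real M / real N + 1) / real M = 1 / real N + 1 / real M" using elim N by (simp add: field_simps)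
    finally show ?case using elim by simp
  qed
qed

lemma widim_antimono:
  assumes "compact (UNIV :: 'a::metric_space set)" "zk_action T" "finite \<Omega>" "\<Omega> \<noteq> {}" "0 < \<epsilon>" "\<epsilon> \<le> \<epsilon>'"
  shows "widim (dOmega T \<Omega> :: 'a \<Rightarrow> 'a \<Rightarrow> real) \<epsilon>' \<le> widim (dOmega T \<Omega> :: 'a \<Rightarrow> 'a \<Rightarrow> real) \<epsilon>"
proof (rule widim_le[OF assms(1-4)])
  show "fine_map (orbit_close T \<Omega> \<epsilon>' :: 'a \<Rightarrow> 'a \<Rightarrow> bool) (widim (dOmega T \<Omega> :: 'a \<Rightarrow> 'a \<Rightarrow> real) \<epsilon>)"
    by (rule fine_map_mono[OF fine_map_widim[OF assms(1-5)]])
      (unfold orbit_close_def, use assms(6) order_less_le_trans in blast)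
qed (use assms(5,6) in simp)

text \<open>Monotone functions with extended real values converge to their supremum, possibly
  infinite, so the outer \<open>Lim\<close> in \<open>mdim\<close> is a genuine limit and not an
  unspecified value.\<close>

lemma Lim_at_right_0_antimono:
  fixes g :: "real \<Rightarrow> ereal"
  assumes "\<And>x y. 0 < x \<Longrightarrow> x \<le> y \<Longrightarrow> g y \<le> g x"
  shows "Lim (at_right 0) g = (SUP x\<in>{0<..}. g x)"
proof (rule tendsto_Lim)
  show "(g \<longlongrightarrow> (SUP x\<in>{0<..}. g x)) (at_right 0)"
  proof (rule order_tendstoI)
    fix u assume "u < (SUP x\<in>{0<..}. g x)"
    then obtain x where "x > 0" "u < g x" by (auto simp: less_SUP_iff)
    then show "\<forall>\<^sub>F y in at_right 0. u < g y"
      unfolding eventually_at_right_field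
      using assms[OF _ less_imp_le] by (intro exI[of _ x]) (auto intro: less_le_trans)
  next
    fix u assume "(SUP x\<in>{0<..}. g x) < u"
    then show "\<forall>\<^sub>F y in at_right 0. g y < u"
      unfolding eventually_at_right_field
      by (intro exI[of _ 1]) (auto intro: le_less_trans[OF SUP_upper])
  qed
qed simp

text \<open>\<open>mdim\<close> is a supremum over scales of infima over box sizes: a strict upper
  bound therefore holds at every scale, and there already for a single box.\<close>

lemma mdim_less_imp_widim_less:
  fixes T :: "int^'k \<Rightarrow> 'a::metric_space \<Rightarrow> 'a"
  assumes "dyn_system T" "mdim T < ereal u" "\<epsilon> > 0"
  obtains N where "N \<ge> 1" "real (widim (dOmega T (Defs.box N)) \<epsilon>) < u * real N ^ CARD('k)"
proof -
  have c: "compact (UNIV :: 'a set)" and T: "zk_action T" using assms(1) by (auto simp: dyn_system_def)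
  define w where "w \<epsilon> N = real (widim (dOmega T (Defs.box N)) \<epsilon>) / real N ^ CARD('k)" for \<epsilon> N
  define g where "g \<epsilon> = (INF N\<in>{1..}. w \<epsilon> N)" for \<epsilon>
  have bdd: "bdd_below (w \<epsilon> ` {1..})" for \<epsilon>
    by (rule bdd_belowI[of _ 0]) (auto simp: w_def)
  have lim: "w \<epsilon> \<longlonglongrightarrow> g \<epsilon>" if "\<epsilon> > 0" for \<epsilon>
    unfolding w_def g_def by (rule Fekete_power[OF widim_box_le[OF c T that]])
  have anti: "g \<epsilon>' \<le> g \<epsilon>" if "0 < \<epsilon>" "\<epsilon> \<le> \<epsilon>'" for \<epsilon> \<epsilon>'
    unfolding g_def
  proof (rule cINF_mono[OF _ bdd])
    fix N :: nat assume "N \<in> {1..}"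
    then have "Defs.box N \<noteq> ({} :: (int^'k) set)" using box_nonempty[of N] by auto
    then have "w \<epsilon>' N \<le> w \<epsilon> N" unfolding w_def
      using widim_antimono[OF c T finite_box _ that] by (intro divide_right_mono) auto
    then show "\<exists>N'\<in>{1..}. w \<epsilon>' N' \<le> w \<epsilon> N" using \<open>N \<in> {1..}\<close> by blast
  qed auto
  have "mdim T = Lim (at_right 0) (\<lambda>\<epsilon>. ereal (lim (w \<epsilon>)))" by (simp add: mdim_def w_def[abs_def])
  also have "\<dots> = (SUP \<epsilon>\<in>{0<..}. ereal (lim (w \<epsilon>)))"
    by (rule Lim_at_right_0_antimono) (simp add: limI[OF lim] anti)
  also have "ereal (lim (w \<epsilon>)) \<le> \<dots>" by (rule SUP_upper) (simp add: assms(3))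
  finally have "ereal (lim (w \<epsilon>)) \<le> mdim T" .
  then have "ereal (g \<epsilon>) < ereal u" using assms(2) unfolding limI[OF lim[OF assms(3)]] by (rule le_less_trans)
  then obtain N where "N \<ge> 1" "w \<epsilon> N < u"
    unfolding g_def using cInf_lessD[of "w \<epsilon> ` {1..}" u] by auto
  then show thesis by (intro that[of N]) (auto simp: w_def divide_less_eq)
qed

section \<open>Clopen markers and Voronoi cells\<close>

text \<open>Freeness makes \<open>z\<close> and \<open>S n z\<close> distinct for each nonzero
  \<open>n\<close> in \<open>E\<close>; separate them by open sets, pull back, intersect over the
  finite set \<open>E\<close>, and shrink to a clopen set.\<close>

lemma clopen_displaced:
  fixes S :: "int^'k \<Rightarrow> 'z::metric_space \<Rightarrow> 'z"
  assumes S: "zk_action S" "aperiodic S" "zero_dimensional_space TYPE('z)" and "finite E"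
  obtains V where "open V" "closed V" "z \<in> V" "\<And>y n. y \<in> V \<Longrightarrow> n \<in> E \<Longrightarrow> n \<noteq> 0 \<Longrightarrow> S n y \<notin> V"
proof -
  have "\<exists>A B. open A \<and> open B \<and> z \<in> A \<and> S n z \<in> B \<and> A \<inter> B = {}" if "n \<noteq> 0" for n
  proof (rule hausdorff)
    show "z \<noteq> S n z"
    proof
      assume "z = S n z"
      then have "S n z = z" by (rule sym)
      from S(2)[unfolded aperiodic_def, rule_format, OF this] show False using that by simp
    qed
  qed
  then have "\<forall>n. \<exists>C. n \<noteq> 0 \<longrightarrow> open (fst C) \<and> open (snd C) \<and> z \<in> fst C \<and> S n z \<in> snd C \<and> fst C \<inter> snd C = {}"
    by simp
  from choice[OF this] obtain C where C: "\<forall>n. n \<noteq> 0 \<longrightarrow> open (fst (C n)) \<and> open (snd (C n)) \<and>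
    z \<in> fst (C n) \<and> S n z \<in> snd (C n) \<and> fst (C n) \<inter> snd (C n) = {}" ..
  define A B where "A n = fst (C n)" and "B n = snd (C n)" for n
  have AB: "open (A n)" "open (B n)" "z \<in> A n" "S n z \<in> B n" "A n \<inter> B n = {}" if "n \<noteq> 0" for n
    using C that by (simp_all add: A_def B_def)
  define G where "G = (\<Inter>n\<in>E - {0}. A n \<inter> S n -` B n)"
  have "open G" unfolding G_def
    using assms(4) AB by (intro open_INT ballI open_Int open_vimage zk_action_cont[OF S(1)]) auto
  moreover have "z \<in> G" using AB by (auto simp: G_def)
  ultimately obtain V where V: "open V" "closed V" "z \<in> V" "V \<subseteq> G"
    using S(3) unfolding zero_dimensional_space_def by blast
  show thesis
  proof (rule that[OF V(1-3)])
    fix y n assume y: "y \<in> V" "n \<in> E" "n \<noteq> 0"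
    show "S n y \<notin> V"
    proof
      assume "S n y \<in> V"
      then have "S n y \<in> A n" using V(4) y by (auto simp: G_def)
      moreover have "S n y \<in> B n" using V(4) y by (auto simp: G_def)
      ultimately show False using AB(5)[OF y(3)] by blast
    qed
  qed
qed

text \<open>A greedy maximal \<open>E\<close>-separated set: the members of a finite clopen cover
  are treated in turn, each contributing those of its points from which the set built so far is not
  yet reached within \<open>E\<close>.\<close>

lemma clopen_marker:
  fixes S :: "int^'k \<Rightarrow> 'z::metric_space \<Rightarrow> 'z"
  assumes S: "dyn_system S" "aperiodic S" "zero_dimensional_space TYPE('z)"
    and E: "finite E" "0 \<in> E" "\<And>n. n \<in> E \<Longrightarrow> - n \<in> E"
  obtains U where "open U" "closed U" "\<And>y n. y \<in> U \<Longrightarrow> n \<in> E \<Longrightarrow> n \<noteq> 0 \<Longrightarrow> S n y \<notin> U"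
    "\<And>z. \<exists>n\<in>E. S n z \<in> U"
proof -
  have zk: "zk_action S" and comp: "compact (UNIV :: 'z set)" using S(1) by (auto simp: dyn_system_def)
  define good where "good V \<longleftrightarrow> open V \<and> closed V \<and> (\<forall>y\<in>V. \<forall>n\<in>E - {0}. S n y \<notin> V)" for V
  have "\<exists>V. z \<in> V \<and> good V" for z
  proof -
    obtain V where "open V" "closed V" "z \<in> V" "\<And>y n. y \<in> V \<Longrightarrow> n \<in> E \<Longrightarrow> n \<noteq> 0 \<Longrightarrow> S n y \<notin> V"
      using clopen_displaced[OF zk S(2,3) E(1)] by blast
    then show ?thesis unfolding good_def by blast
  qed
  then obtain V where V: "\<And>z. z \<in> V z" "\<And>z. good (V z)" by metis
  have "UNIV \<subseteq> (\<Union>z. V z)" using V(1) by blast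
  then obtain C where C: "finite C" "UNIV \<subseteq> (\<Union>z\<in>C. V z)"
    using compactE_image[OF comp, of UNIV V] V(2) by (auto simp: good_def)
  have "\<exists>U. good U \<and> (\<forall>z\<in>\<Union>(V ` D). \<exists>n\<in>E. S n z \<in> U)" if "finite D" for D
    using that
  proof (induction D rule: finite_induct)
    case empty
    show ?case by (intro exI[of _ "{}"]) (auto simp: good_def)
  next
    case (insert d D)
    then obtain U where U: "good U" "\<forall>z\<in>\<Union>(V ` D). \<exists>n\<in>E. S n z \<in> U" by blast
    define X where "X = (\<Union>n\<in>E. S n -` U)"
    \<comment> \<open>\<open>X\<close> is where \<open>U\<close> is already reached within
      \<open>E\<close>. Added points cannot reach \<open>U\<close>, by symmetry of \<open>E\<close>
      points of \<open>U\<close> cannot reach them, and among themselves they are separated because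
      \<open>V d\<close> is. They reach the new set at time 0.\<close>
    define U' where "U' = U \<union> (V d - X)"
    have oX: "open X" unfolding X_def
      using U(1) by (intro open_UN ballI open_vimage zk_action_cont[OF zk]) (auto simp: good_def)
    have cX: "closed X" unfolding X_def
      using U(1) E(1) by (intro closed_UN ballI closed_vimage zk_action_cont[OF zk]) (auto simp: good_def)
    have "S n y \<notin> U'" if y: "y \<in> U'" "n \<in> E" "n \<noteq> 0" for y n
    proof
      assume *: "S n y \<in> U'"
      have "y \<in> X" if "S n y \<in> U" using that y(2) by (auto simp: X_def)
      moreover have "S n y \<in> X" if "y \<in> U"
      proof -
        have "S (- n) (S n y) = y" by (simp add: zk_action_comp[OF zk] zk_action_0[OF zk])
        then have "S (- n) (S n y) \<in> U" using that by simp
        then show ?thesis using E(3)[OF y(2)] unfolding X_def by blast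
      qed
      ultimately show False
        using * y U(1) V(2)[of d] by (auto simp: U'_def good_def)
    qed
    moreover have "open U'" "closed U'"
      using U(1) V(2)[of d] oX cX unfolding U'_def good_def by (auto intro: open_Diff closed_Diff)
    ultimately have "good U'" unfolding good_def by blast
    moreover have "\<exists>n\<in>E. S n z \<in> U'" if "z \<in> \<Union>(V ` insert d D)" for z
    proof (cases "z \<in> X")
      case True
      then show ?thesis by (auto simp: X_def U'_def)
    next
      case False
      then have "z \<in> V d" using that U(2) by (auto simp: X_def)
      then have "S 0 z \<in> U'" using False by (simp add: U'_def zk_action_0[OF zk])
      then show ?thesis using E(2) by blast
    qed
    ultimately show ?case by blast
  qed
  from this[OF C(1)] obtain U where U: "good U" "\<forall>z\<in>\<Union>(V ` C). \<exists>n\<in>E. S n z \<in> U" by blast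
  show thesis
  proof (rule that[of U])
    show "\<exists>n\<in>E. S n z \<in> U" for z
    proof -
      have "z \<in> \<Union>(V ` C)" using C(2) by auto
      with U(2) show ?thesis by (rule bspec)
    qed
    show "S n y \<notin> U" if "y \<in> U" "n \<in> E" "n \<noteq> 0" for y n
      using U(1) that unfolding good_def by blast
    show "open U" "closed U" using U(1) unfolding good_def by blast+
  qed
qed

section \<open>Voronoi cells of lattice points and their size\<close>

definition vec_real :: "int^'k \<Rightarrow> real^'k" where
  "vec_real n = (\<chi> i. real_of_int (n $ i))"

lemma vec_real_simps [simp]:
  "vec_real 0 = 0" "vec_real (n + m) = vec_real n + vec_real m"
  "vec_real (n - m) = vec_real n - vec_real m" "vec_real (- n) = - vec_real n"
  by (simp_all add: vec_real_def vec_eq_iff)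

lemma finite_vec_real_ball: "finite {n :: int^'k. norm (vec_real n) \<le> r}"
proof (rule finite_subset[OF _ finite_vec_set])
  show "{n :: int^'k. norm (vec_real n) \<le> r} \<subseteq> {n. \<forall>i. n $ i \<in> {-\<lceil>r\<rceil>..\<lceil>r\<rceil>}}"
  proof safe
    fix n :: "int^'k" and i assume "norm (vec_real n) \<le> r"
    then have "\<bar>real_of_int (n $ i)\<bar> \<le> r"
      using component_le_norm_cart[of "vec_real n" i] by (simp add: vec_real_def)
    then show "n $ i \<in> {-\<lceil>r\<rceil>..\<lceil>r\<rceil>}" unfolding atLeastAtMost_iff by linarith
  qed
qed simp

text \<open>A point close to the closed half-space nearer to 0 than to c, scaled towards 0 by 1 - s, ends up
  well inside the open half-space, provided that c is far from 0.\<close>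

lemma norm_less_norm_diff_shrink:
  fixes w x q c :: "'v::real_inner"
  assumes w: "norm w \<le> norm (w - c)" and x: "norm (x - w) \<le> \<kappa>" and q: "norm ((1 - s) *\<^sub>R x - q) \<le> \<kappa>'"
    and s: "0 < s" "s < 1" "s * norm c > 2 * (\<kappa> + \<kappa>')"
  shows "norm q < norm (q - c)"
proof -
  have k: "0 \<le> \<kappa>" "0 \<le> \<kappa>'" using x q norm_ge_zero order_trans by blast+
  have c: "norm c > 0" using s k by (cases "c = 0") auto
  \<comment> \<open>Comparing distances to 0 and to \<open>c\<close> is a linear condition on
    \<open>p\<close>. Scaling by 1 - s gains s |c|^2, while the two displacements cost at most 2
    (\<kappa> + \<kappa>') |c|.\<close>
  have iff: "(norm p)\<^sup>2 \<le> (norm (p - c))\<^sup>2 \<longleftrightarrow> 2 * (p \<bullet> c) \<le> (norm c)\<^sup>2"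
    "(norm p)\<^sup>2 < (norm (p - c))\<^sup>2 \<longleftrightarrow> 2 * (p \<bullet> c) < (norm c)\<^sup>2" for p
    unfolding power2_norm_eq_inner by (auto simp: inner_diff inner_commute)
  have "(norm w)\<^sup>2 \<le> (norm (w - c))\<^sup>2" using w by (simp add: power_mono)
  then have wc: "2 * (w \<bullet> c) \<le> (norm c)\<^sup>2" using iff by blast
  have "(x - w) \<bullet> c \<le> \<kappa> * norm c"
    using norm_cauchy_schwarz[of "x - w" c] mult_right_mono[OF x, of "norm c"] by simp
  then have "2 * (x \<bullet> c) \<le> (norm c)\<^sup>2 + 2 * \<kappa> * norm c" using wc by (simp add: inner_diff)
  then have "(1 - s) * (2 * (x \<bullet> c)) \<le> (1 - s) * ((norm c)\<^sup>2 + 2 * \<kappa> * norm c)"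
    using s by (intro mult_left_mono) auto
  also have "\<dots> = (norm c)\<^sup>2 - s * (norm c)\<^sup>2 + (1 - s) * (2 * \<kappa> * norm c)" by (simp add: algebra_simps)
  also have "(1 - s) * (2 * \<kappa> * norm c) \<le> 1 * (2 * \<kappa> * norm c)"
    using s k by (intro mult_right_mono) auto
  finally have 1: "(1 - s) * (2 * (x \<bullet> c)) \<le> (norm c)\<^sup>2 - s * (norm c)\<^sup>2 + 2 * \<kappa> * norm c" by simp
  have "(q - (1 - s) *\<^sub>R x) \<bullet> c \<le> \<kappa>' * norm c"
    using norm_cauchy_schwarz[of "q - (1 - s) *\<^sub>R x" c] mult_right_mono[OF q, of "norm c"]
    by (simp add: norm_minus_commute)
  then have "2 * (q \<bullet> c) \<le> (1 - s) * (2 * (x \<bullet> c)) + 2 * \<kappa>' * norm c" by (simp add: inner_diff)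
  with 1 have 2: "2 * (q \<bullet> c) \<le> (norm c)\<^sup>2 - s * (norm c)\<^sup>2 + 2 * \<kappa> * norm c + 2 * \<kappa>' * norm c" by simp
  have "2 * (\<kappa> + \<kappa>') * norm c < s * norm c * norm c" using s(3) c by simp
  then have "2 * (q \<bullet> c) < (norm c)\<^sup>2" using 2 by (simp add: power2_eq_square algebra_simps)
  then have "(norm q)\<^sup>2 < (norm (q - c))\<^sup>2" using iff by blast
  then show ?thesis by (simp add: power_less_imp_less_base)
qed

definition cube_at :: "int^'k \<Rightarrow> (real^'k) set" where
  "cube_at n = cbox (vec_real n) (vec_real n + 1)"

text \<open>Counting by volume: the scaled cubes of \<open>A\<close> do not overlap, have volume r^k
  each, and lie in the union of the unit cubes of \<open>W\<close>.\<close>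

lemma card_le_of_scaled_cubes:
  fixes A W :: "(int^'k) set"
  assumes "finite A" "finite W" "0 < r" "r \<le> 1"
    and sub: "\<And>n x. n \<in> A \<Longrightarrow> x \<in> cube_at n \<Longrightarrow> \<exists>q\<in>W. r *\<^sub>R x \<in> cube_at q"
  shows "r ^ CARD('k) * card A \<le> card W"
proof -
  \<comment> \<open>Open scaled cubes, since neighbouring closed ones share faces; the volume is the
    same.\<close>
  define B where "B n = Topology_Euclidean_Space.box (r *\<^sub>R vec_real n) (r *\<^sub>R (vec_real n + 1))"
    for n :: "int^'k"
  have mB: "measure lborel (B n) = r ^ CARD('k)" for n
  proof -
    have "measure lborel (B n) = measure lborel (cbox (r *\<^sub>R vec_real n) (r *\<^sub>R (vec_real n + 1)))"
      unfolding B_def measure_lborel_box_eq measure_lborel_cbox_eq ..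
    also have "\<dots> = r ^ CARD('k)"
      using assms(3) by (subst content_cbox_cart) (simp_all add: interval_ne_empty_cart algebra_simps)
    finally show ?thesis .
  qed
  have mC: "measure lborel (cube_at n) = 1" for n :: "int^'k"
    unfolding cube_at_def by (subst content_cbox_cart) (simp_all add: interval_ne_empty_cart)
  have dis: "disjoint_family_on B A"
    unfolding disjoint_family_on_def
  proof safe
    fix n m x assume "n \<in> A" "m \<in> A" "n \<noteq> m" and x: "x \<in> B n" "x \<in> B m"
    have "n $ i = m $ i" for i
    proof -
      have "r * n $ i < x $ i" "x $ i < r * (n $ i + 1)" "r * m $ i < x $ i" "x $ i < r * (m $ i + 1)"
        using x by (auto simp: B_def mem_box_cart vec_real_def)
      then have "r * n $ i < r * (m $ i + 1)" "r * m $ i < r * (n $ i + 1)" by linarith+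
      then have "real_of_int (n $ i) < m $ i + 1" "real_of_int (m $ i) < n $ i + 1"
        using assms(3) by simp_all
      then show ?thesis by linarith
    qed
    then show "x \<in> {}" using \<open>n \<noteq> m\<close> by (simp add: vec_eq_iff)
  qed
  have BU: "(\<Union>n\<in>A. B n) \<subseteq> (\<Union>q\<in>W. cube_at q)"
  proof safe
    fix n x assume n: "n \<in> A" and x: "x \<in> B n"
    have "(1 / r) *\<^sub>R x \<in> cube_at n"
      using x assms(3) by (auto simp: B_def cube_at_def mem_box_cart field_simps less_imp_le)
    then show "x \<in> (\<Union>q\<in>W. cube_at q)" using sub[OF n] assms(3) by force
  qed
  have "r ^ CARD('k) * card A = (\<Sum>n\<in>A. measure lborel (B n))" by (simp add: mB)
  also have "\<dots> = measure lborel (\<Union>n\<in>A. B n)"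
  proof (rule measure_finite_Union[symmetric, OF assms(1) _ dis])
    show "emeasure lborel (B n) \<noteq> \<infinity>" for n
      unfolding B_def using emeasure_lborel_box_finite by (metis less_irrefl)
  qed (auto simp: B_def)
  also have "\<dots> \<le> measure lborel (\<Union>q\<in>W. cube_at q)"
    by (rule measure_mono_fmeasurable[OF BU])
      (auto simp: B_def cube_at_def assms(1,2) intro!: fmeasurable.finite_UN)
  also have "\<dots> \<le> (\<Sum>q\<in>W. measure lborel (cube_at q))"
    by (rule measure_UNION_le[OF assms(2)]) (simp add: cube_at_def)
  also have "\<dots> = card W" by (simp add: mC)
  finally show ?thesis .
qed

text \<open>Voronoi cell of the centre 0 against the other centres \<open>P\<close>, without ties.
  The cut at radius \<open>R\<close> makes the cell depend on finitely many centres: two cells can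
  interfere only if their centres are within 2 R.\<close>

definition open_cell :: "real \<Rightarrow> (int^'k) set \<Rightarrow> (int^'k) set" where
  "open_cell R P = {n. norm (vec_real n) \<le> R \<and> (\<forall>c\<in>P. norm (vec_real n) < norm (vec_real n - vec_real c))}"

definition closed_cell :: "real \<Rightarrow> (int^'k) set \<Rightarrow> (int^'k) set" where
  "closed_cell R P = {n. norm (vec_real n) \<le> R \<and> (\<forall>c\<in>P. norm (vec_real n) \<le> norm (vec_real n - vec_real c))}"

lemma finite_cells: "finite (open_cell R P)" "finite (closed_cell R P)"
  by (rule finite_subset[OF _ finite_vec_real_ball[of R]]; auto simp: open_cell_def closed_cell_def)+

text \<open>Shrinking by 1 - s moves every unit cube near the closed cell into the unit cubes of the
  open cell, because all centres are at distance at least \<open>R\<close> and \<open>s * R\<close>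
  exceeds twice the total displacement. Volumes then compare with the factor (1 - s)^k.\<close>

lemma card_near_closed_cell:
  fixes P A :: "(int^'k) set" and R s :: real and N :: nat
  assumes s: "0 < s" "s < 1" "s * R > 2 * (CARD('k) * (N + 1) + CARD('k))"
    and P: "\<And>c. c \<in> P \<Longrightarrow> R \<le> norm (vec_real c)"
    and A: "finite A" "\<And>n. n \<in> A \<Longrightarrow> \<exists>w\<in>closed_cell R P. \<forall>i. \<bar>n $ i - w $ i\<bar> \<le> int N"
  shows "(1 - s) ^ CARD('k) * card A \<le> card (open_cell R P)"
proof (rule card_le_of_scaled_cubes)
  fix n x assume n: "n \<in> A" and x: "x \<in> cube_at n"
  obtain w where w: "w \<in> closed_cell R P" "\<And>i. \<bar>n $ i - w $ i\<bar> \<le> int N" using A(2)[OF n] by blast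
  define q :: "int^'k" where "q = (\<chi> i. \<lfloor>(1 - s) * x $ i\<rfloor>)"
  \<comment> \<open>A point of the cube at \<open>n\<close> differs from \<open>w\<close> by at most
    N + 1 in each coordinate, and rounding down changes each coordinate by at most 1
    (\<open>\<kappa>'\<close>); both are turned into norm bounds through the l1 norm.\<close>
  define \<kappa> where "\<kappa> = real CARD('k) * (real N + 1)"
  define \<kappa>' where "\<kappa>' = real CARD('k)"
  have xw: "norm (x - vec_real w) \<le> \<kappa>"
  proof -
    have "\<bar>(x - vec_real w) $ i\<bar> \<le> real N + 1" for i
    proof -
      have "real_of_int (n $ i) \<le> x $ i" "x $ i \<le> n $ i + 1"
        using x by (auto simp: cube_at_def mem_box_cart vec_real_def)
      moreover have "\<bar>real_of_int (n $ i - w $ i)\<bar> \<le> real N" using w(2)[of i] by linarith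
      ultimately show ?thesis by (simp add: vec_real_def)
    qed
    then have "(\<Sum>i\<in>UNIV. \<bar>(x - vec_real w) $ i\<bar>) \<le> \<kappa>"
      unfolding \<kappa>_def by (intro order_trans[OF sum_bounded_above]) auto
    then show ?thesis using norm_le_l1_cart[of "x - vec_real w"] by linarith
  qed
  have xq: "norm ((1 - s) *\<^sub>R x - vec_real q) \<le> \<kappa>'"
  proof -
    have "\<bar>((1 - s) *\<^sub>R x - vec_real q) $ i\<bar> \<le> 1" for i
      unfolding q_def vec_real_def by simp linarith
    then have "(\<Sum>i\<in>UNIV. \<bar>((1 - s) *\<^sub>R x - vec_real q) $ i\<bar>) \<le> \<kappa>'"
      unfolding \<kappa>'_def by (intro order_trans[OF sum_bounded_above]) auto
    then show ?thesis using norm_le_l1_cart[of "(1 - s) *\<^sub>R x - vec_real q"] by linarith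
  qed
  have sR: "s * R > 2 * (\<kappa> + \<kappa>')" using s(3) by (simp add: \<kappa>_def \<kappa>'_def algebra_simps)
  have kk: "0 \<le> \<kappa>" "0 \<le> \<kappa>'" by (auto simp: \<kappa>_def \<kappa>'_def)
  have "norm (vec_real q) < norm (vec_real q - vec_real c)" if "c \<in> P" for c
  proof (rule norm_less_norm_diff_shrink[OF _ xw xq s(1,2)])
    show "norm (vec_real w) \<le> norm (vec_real w - vec_real c)" using w(1) that by (auto simp: closed_cell_def)
    show "2 * (\<kappa> + \<kappa>') < s * norm (vec_real c)"
      using sR mult_left_mono[OF P[OF that], of s] s(1) by linarith
  qed
  moreover have "norm (vec_real q) \<le> R"
  proof -
    have "norm (vec_real w) \<le> R" using w(1) by (simp add: closed_cell_def)
    then have "norm x \<le> R + \<kappa>" using xw norm_triangle_sub[of x "vec_real w"] by linarith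
    then have "(1 - s) * norm x \<le> (1 - s) * (R + \<kappa>)" using s by (intro mult_left_mono) auto
    also have "\<dots> \<le> R - s * R + \<kappa>" using s kk by (simp add: algebra_simps)
    finally have "norm ((1 - s) *\<^sub>R x) \<le> R - s * R + \<kappa>" using s by simp
    then have "norm (vec_real q) \<le> R - s * R + \<kappa> + \<kappa>'"
      using xq norm_triangle_sub[of "vec_real q" "(1 - s) *\<^sub>R x"] by (simp add: norm_minus_commute)
    moreover have "2 * \<kappa> + 2 * \<kappa>' < s * R" using sR by (simp add: algebra_simps)
    ultimately show ?thesis using kk by linarith
  qed
  ultimately have "q \<in> open_cell R P" by (simp add: open_cell_def)
  moreover have "(1 - s) *\<^sub>R x \<in> cube_at q"
    unfolding cube_at_def mem_box_cart q_def vec_real_def by simp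
  ultimately show "\<exists>q\<in>open_cell R P. (1 - s) *\<^sub>R x \<in> cube_at q" by blast
next
  show "finite (open_cell R P)" "finite A" "0 < 1 - s" "1 - s \<le> 1"
    using s A(1) finite_cells by simp_all
qed

text \<open>\<open>A\<close> consists of the corners of the boxes of the N-grid that meet the closed
  cell. Grid boxes are disjoint, so \<open>card A * N ^ CARD('k)\<close> counts the lattice points
  in their union, all of which are within N of the cell.\<close>

lemma closed_cell_box_cover:
  fixes P :: "(int^'k) set" and R s :: real and N :: nat
  assumes s: "0 < s" "s < 1" "s * R > 2 * (CARD('k) * (N + 1) + CARD('k))"
    and P: "\<And>c. c \<in> P \<Longrightarrow> R \<le> norm (vec_real c)" and N: "N \<ge> 1"
  obtains A where "finite A" "closed_cell R P \<subseteq> (\<Union>a\<in>A. (\<lambda>n. n + a) ` Defs.box N)"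
    "(1 - s) ^ CARD('k) * real (card A * N ^ CARD('k)) \<le> card (open_cell R P)"
proof -
  define f :: "int^'k \<Rightarrow> int^'k" where "f w = (\<chi> i. int N * (w $ i div int N))" for w
  define A where "A = f ` closed_cell R P"
  have finA: "finite A" by (simp add: A_def finite_cells)
  have inj: "inj_on (\<lambda>(a,r). r + a) (A \<times> Defs.box N)"
  proof (rule inj_onI, clarify)
    fix a r a' r' assume *: "a \<in> A" "r \<in> Defs.box N" "a' \<in> A" "r' \<in> Defs.box N" "r + a = r' + a'"
    obtain w w' where w: "a = f w" "a' = f w'" using * by (auto simp: A_def)
    have "a $ i = a' $ i" for i
    proof -
      have r: "0 \<le> r $ i" "r $ i < int N" "0 \<le> r' $ i" "r' $ i < int N"
        using * by (auto simp: Defs.box_def)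
      have "r $ i + int N * (w $ i div int N) = r' $ i + int N * (w' $ i div int N)"
        using *(5) by (simp add: w f_def vec_eq_iff)
      then have "(r $ i + int N * (w $ i div int N)) div int N = (r' $ i + int N * (w' $ i div int N)) div int N"
        by simp
      then have "w $ i div int N = w' $ i div int N" using r N by simp
      then show ?thesis by (simp add: w f_def)
    qed
    then have "a = a'" by (simp add: vec_eq_iff)
    then show "a = a' \<and> r = r'" using *(5) by simp
  qed
  define A' where "A' = (\<Union>a\<in>A. (\<lambda>n. n + a) ` Defs.box N)"
  have "A' = (\<lambda>(a,r). r + a) ` (A \<times> Defs.box N)" by (auto simp: A'_def)
  then have cA': "card A' = card A * N ^ CARD('k)"
    by (simp add: card_image[OF inj] card_cartesian_product card_box)
  have "(1 - s) ^ CARD('k) * real (card A') \<le> card (open_cell R P)"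
  proof (rule card_near_closed_cell[OF s P])
    show "finite A'" using finA by (simp add: A'_def finite_box)
    fix n assume "n \<in> A'"
    then obtain w r where w: "w \<in> closed_cell R P" "r \<in> Defs.box N" "n = r + f w" by (auto simp: A'_def A_def)
    have "\<bar>n $ i - w $ i\<bar> \<le> int N" for i
    proof -
      have "0 \<le> r $ i" "r $ i < int N" using w(2) by (auto simp: Defs.box_def)
      moreover have "w $ i = int N * (w $ i div int N) + w $ i mod int N" by simp
      moreover have "0 \<le> w $ i mod int N" "w $ i mod int N < int N" using N by auto
      moreover have "n $ i = r $ i + int N * (w $ i div int N)" by (simp add: w f_def)
      ultimately show ?thesis by linarith
    qed
    then show "\<exists>w\<in>closed_cell R P. \<forall>i. \<bar>n $ i - w $ i\<bar> \<le> int N" using w(1) by blast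
  qed
  moreover have "closed_cell R P \<subseteq> A'"
  proof
    fix w assume w: "w \<in> closed_cell R P"
    have "w = (\<chi> i. w $ i mod int N) + f w" by (simp add: vec_eq_iff f_def)
    moreover have "(\<chi> i. w $ i mod int N) \<in> Defs.box N" using N by (simp add: Defs.box_def)
    ultimately show "w \<in> A'" using w unfolding A'_def A_def by blast
  qed
  ultimately show thesis
    using that[OF finA] unfolding cA' unfolding A'_def by blast
qed

text \<open>The base sets U P of the towers are indexed by the set P of nearby return times to a clopen
  marker set. The open Voronoi cells keep the levels disjoint, while the closed ones cover.\<close>

lemma clopen_towers:
  fixes S :: "int^'k \<Rightarrow> 'z::metric_space \<Rightarrow> 'z" and \<theta> :: real and N :: nat
  assumes S: "dyn_system S" "aperiodic S" "zero_dimensional_space TYPE('z)"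
    and \<theta>: "0 < \<theta>" "\<theta> < 1" and N: "N \<ge> 1"
  obtains I :: "(int^'k) set set" and U :: "(int^'k) set \<Rightarrow> 'z set" and W W' A :: "(int^'k) set \<Rightarrow> (int^'k) set"
  where "finite I" "\<And>P. P \<in> I \<Longrightarrow> open (U P)" "\<And>P. P \<in> I \<Longrightarrow> closed (U P)"
    "\<And>P. P \<in> I \<Longrightarrow> finite (W P)" "\<And>P. P \<in> I \<Longrightarrow> 0 \<in> W P" "\<And>P. P \<in> I \<Longrightarrow> W P \<subseteq> W' P"
    "\<And>P. P \<in> I \<Longrightarrow> finite (A P)" "\<And>P. P \<in> I \<Longrightarrow> W' P \<subseteq> (\<Union>a\<in>A P. (\<lambda>n. n + a) ` Defs.box N)"
    "\<And>P. P \<in> I \<Longrightarrow> \<theta> * real (card (A P) * N ^ CARD('k)) \<le> card (W P)"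
    "\<And>P Q n m y y'. P \<in> I \<Longrightarrow> Q \<in> I \<Longrightarrow> n \<in> W P \<Longrightarrow> m \<in> W Q \<Longrightarrow> y \<in> U P \<Longrightarrow> y' \<in> U Q \<Longrightarrow>
       S n y = S m y' \<Longrightarrow> P = Q \<and> n = m"
    "\<And>z. \<exists>P\<in>I. \<exists>n\<in>W' P. \<exists>y\<in>U P. z = S n y"
proof -
  have zk: "zk_action S" using S(1) by (auto simp: dyn_system_def)
  \<comment> \<open>Chosen so that Bernoulli's inequality gives (1 - s)^k \<ge> 1 - k s =
    \<theta>.\<close>
  define s where "s = (1 - \<theta>) / CARD('k)"
  have s: "0 < s" "s < 1"
  proof -
    show "0 < s" using \<theta> by (simp add: s_def)
    have "s \<le> (1 - \<theta>) / 1" unfolding s_def using \<theta> by (intro divide_left_mono) auto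
    then show "s < 1" using \<theta> by simp
  qed
  have "1 + real CARD('k) * (- s) \<le> (1 + (- s)) ^ CARD('k)"
    by (rule Bernoulli_inequality) (use s in simp)
  then have \<theta>s: "\<theta> \<le> (1 - s) ^ CARD('k)" by (simp add: s_def)
  define R where "R = (real (2 * (CARD('k) * (N + 1) + CARD('k))) + 1) / s"
  have sR: "s * R > 2 * (CARD('k) * (N + 1) + CARD('k))" using s by (simp add: R_def)
  have R: "R > 0" unfolding R_def using s by (intro divide_pos_pos add_nonneg_pos of_nat_0_le_iff) simp_all
  define E where "E = {n :: int^'k. norm (vec_real n) < R}"
  have E: "finite E" "0 \<in> E" "\<And>n. n \<in> E \<Longrightarrow> - n \<in> E"
  proof -
    have "E \<subseteq> {n. norm (vec_real n) \<le> R}" by (auto simp: E_def)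
    then show "finite E" using finite_vec_real_ball by (rule finite_subset)
  qed (use R in \<open>auto simp: E_def\<close>)
  obtain V where V: "open V" "closed V" "\<And>y n. y \<in> V \<Longrightarrow> n \<in> E \<Longrightarrow> n \<noteq> 0 \<Longrightarrow> S n y \<notin> V"
    "\<And>z. \<exists>n\<in>E. S n z \<in> V"
    using clopen_marker[OF S E] by blast
  \<comment> \<open>Differences of two positions in cells of radius \<open>R\<close> have norm at
    most 2 R, so return times in \<open>B\<close> decide every possible collision of levels.\<close>
  define B where "B = {c :: int^'k. norm (vec_real c) \<le> 2 * R} - {0}"
  have finB: "finite B" unfolding B_def using finite_vec_real_ball by blast
  define U where "U P = V \<inter> (\<Inter>c\<in>B. if c \<in> P then S c -` V else - (S c -` V))" for P
  have U: "y \<in> U P \<longleftrightarrow> y \<in> V \<and> (\<forall>c\<in>B. S c y \<in> V \<longleftrightarrow> c \<in> P)" for y P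
  proof -
    have "y \<in> (if c \<in> P then S c -` V else - (S c -` V)) \<longleftrightarrow> (S c y \<in> V \<longleftrightarrow> c \<in> P)" for c by simp
    then show ?thesis unfolding U_def Int_iff INT_iff by simp
  qed
  \<comment> \<open>Only patterns that occur: a point of \<open>U P\<close> is what shows, via the
    separation of the marker, that all elements of \<open>P\<close> have norm at least
    \<open>R\<close>.\<close>
  define I where "I = {P \<in> Pow B. U P \<noteq> {}}"
  have far: "R \<le> norm (vec_real c)" if "P \<in> I" "c \<in> P" for P c
  proof (rule ccontr)
    assume "\<not> ?thesis"
    then have "c \<in> E" by (simp add: E_def)
    obtain y where "y \<in> U P" using \<open>P \<in> I\<close> by (auto simp: I_def)
    moreover have "c \<in> B" using that by (auto simp: I_def)
    ultimately have "y \<in> V" "S c y \<in> V" using U that(2) by auto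
    then show False using V(3)[OF _ \<open>c \<in> E\<close>] \<open>c \<in> B\<close> by (auto simp: B_def)
  qed
  have "\<exists>A. finite A \<and> closed_cell R P \<subseteq> (\<Union>a\<in>A. (\<lambda>n. n + a) ` Defs.box N) \<and>
    (1 - s) ^ CARD('k) * real (card A * N ^ CARD('k)) \<le> card (open_cell R P)" if "P \<in> I" for P
    using closed_cell_box_cover[OF s sR far[OF that] N] by metis
  then have "\<forall>P\<in>I. \<exists>A. finite A \<and> closed_cell R P \<subseteq> (\<Union>a\<in>A. (\<lambda>n. n + a) ` Defs.box N) \<and>
    (1 - s) ^ CARD('k) * real (card A * N ^ CARD('k)) \<le> card (open_cell R P)" by blast
  from bchoice[OF this] obtain A where A: "\<forall>P\<in>I. finite (A P) \<and>
      closed_cell R P \<subseteq> (\<Union>a\<in>A P. (\<lambda>n. n + a) ` Defs.box N) \<and>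
      (1 - s) ^ CARD('k) * real (card (A P) * N ^ CARD('k)) \<le> card (open_cell R P)" ..
  show thesis
  proof (rule that[of I U "open_cell R" "closed_cell R" A])
    show "finite I" using finB by (simp add: I_def)
    have op: "open (S c -` V)" and cl: "closed (S c -` V)" for c
      using V(1,2) by (auto intro: open_vimage closed_vimage zk_action_cont[OF zk])
    show "open (U P)" for P
      unfolding U_def using V(1) finB op cl by (intro open_Int open_INT ballI) auto
    show "closed (U P)" for P
      unfolding U_def using V(2) op cl by (intro closed_Int closed_INT ballI) auto
    show "finite (open_cell R P)" for P by (rule finite_cells)
    show "0 \<in> open_cell R P" if "P \<in> I" for P
      using far[OF that] R by (force simp: open_cell_def)
    show "open_cell R P \<subseteq> closed_cell R P" for P
      by (auto simp: open_cell_def closed_cell_def less_imp_le)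
    show "finite (A P)" "closed_cell R P \<subseteq> (\<Union>a\<in>A P. (\<lambda>n. n + a) ` Defs.box N)" if "P \<in> I" for P
      using A that by blast+
    show "\<theta> * real (card (A P) * N ^ CARD('k)) \<le> card (open_cell R P)" if "P \<in> I" for P
    proof -
      have "\<theta> * real (card (A P) * N ^ CARD('k)) \<le> (1 - s) ^ CARD('k) * real (card (A P) * N ^ CARD('k))"
        by (rule mult_right_mono[OF \<theta>s]) simp
      then show ?thesis using A that by fastforce
    qed
    \<comment> \<open>If levels \<open>n\<close> and \<open>m\<close> met with \<open>n\<close>
      different from \<open>m\<close>, then \<open>n - m\<close> would be a return time of
      \<open>y\<close>, hence a competing centre in \<open>P\<close>, and position \<open>n\<close>
      would be strictly nearer to 0 than to it. Exchanging the roles gives the reverse strict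
      inequality.\<close>
    have less: "norm (vec_real n) < norm (vec_real m)"
      if n: "n \<in> open_cell R P" and m: "m \<in> open_cell R Q" and y: "y \<in> U P" "y' \<in> U Q"
        and eq: "S n y = S m y'" and ne: "n \<noteq> m" for P Q n m y y'
    proof -
      have "S (n - m) y = S (- m) (S n y)" by (simp add: zk_action_comp[OF zk])
      also have "\<dots> = y'" unfolding eq by (simp add: zk_action_comp[OF zk] zk_action_0[OF zk])
      finally have "S (n - m) y \<in> V" using y U by simp
      moreover have "norm (vec_real n) \<le> R" "norm (vec_real m) \<le> R" using n m by (auto simp: open_cell_def)
      then have "n - m \<in> B" using ne norm_triangle_ineq4[of "vec_real n" "vec_real m"] by (simp add: B_def)
      ultimately have "n - m \<in> P" using y(1) U by blast
      then have "norm (vec_real n) < norm (vec_real n - vec_real (n - m))" using n unfolding open_cell_def by blast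
      then show ?thesis by simp
    qed
    show "P = Q \<and> n = m"
      if "P \<in> I" "Q \<in> I" and n: "n \<in> open_cell R P" and m: "m \<in> open_cell R Q" and y: "y \<in> U P" "y' \<in> U Q"
        and eq: "S n y = S m y'" for P Q n m y y'
    proof -
      have nm: "n = m"
      proof (rule ccontr)
        assume "n \<noteq> m"
        then show False using less[OF n m y eq] less[OF m n y(2,1) eq[symmetric]] by auto
      qed
      have "y = S (- n) (S n y)" by (simp add: zk_action_comp[OF zk] zk_action_0[OF zk])
      also have "\<dots> = S (- m) (S m y')" unfolding eq unfolding nm ..
      also have "\<dots> = y'" by (simp add: zk_action_comp[OF zk] zk_action_0[OF zk])
      finally have "y = y'" .
      have "c \<in> P \<longleftrightarrow> c \<in> Q" if "c \<in> B" for c using y that U \<open>y = y'\<close> by simp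
      then have "P = Q" using \<open>P \<in> I\<close> \<open>Q \<in> I\<close> unfolding I_def by blast
      then show ?thesis using nm by simp
    qed
    show "\<exists>P\<in>I. \<exists>n\<in>closed_cell R P. \<exists>y\<in>U P. z = S n y" for z
    proof -
      define D where "D = {c \<in> E. S c z \<in> V}"
      have D: "finite D" "D \<noteq> {}" using E(1) V(4)[of z] by (auto simp: D_def)
      obtain c where c: "c \<in> D" "\<And>c'. c' \<in> D \<Longrightarrow> norm (vec_real c) \<le> norm (vec_real c')"
        using ex_min_if_finite[of "(\<lambda>c. norm (vec_real c)) ` D"] D by (auto simp: not_less)
      define y P where "y = S c z" and "P = {c' \<in> B. S c' y \<in> V}"
      have yU: "y \<in> U P" using c(1) by (auto simp: U D_def y_def P_def)
      then have PI: "P \<in> I" by (auto simp: I_def P_def)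
      have cR: "norm (vec_real c) < R" using c(1) by (simp add: D_def E_def)
      \<comment> \<open>The base point \<open>y\<close> is the nearest visit of \<open>z\<close> to
        the marker, so \<open>z\<close> sits at position \<open>- c\<close>. A strictly closer
        centre \<open>c'\<close> would be a visit at time \<open>c' + c\<close> of smaller norm,
        still inside \<open>E\<close>, against the choice of \<open>c\<close>.\<close>
      have "norm (vec_real (- c)) \<le> norm (vec_real (- c) - vec_real c')" if "c' \<in> P" for c'
      proof (rule ccontr)
        assume *: "\<not> ?thesis"
        have eq: "norm (vec_real (- c) - vec_real c') = norm (vec_real (c' + c))"
        proof -
          have "vec_real (- c) - vec_real c' = - vec_real (c' + c)" by simp
          then show ?thesis by (simp only: norm_minus_cancel)
        qed
        have "S (c' + c) z \<in> V" using that by (simp add: P_def y_def zk_action_comp[OF zk])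
        moreover have "c' + c \<in> E" using * cR unfolding eq by (simp add: E_def)
        ultimately have "c' + c \<in> D" by (simp add: D_def)
        then show False using c(2) * unfolding eq by force
      qed
      then have "- c \<in> closed_cell R P" using cR by (auto simp: closed_cell_def)
      moreover have "z = S (- c) y" by (simp add: y_def zk_action_comp[OF zk] zk_action_0[OF zk])
      ultimately show ?thesis using yU PI by blast
    qed
  qed
qed

section \<open>Affinely generic points\<close>

text \<open>Induction on the equations by elimination: a nonzero coefficient of the new equation
  serves as pivot, its unknown is removed from the others, and it is recovered at the end.\<close>

lemma homogeneous_system_nontrivial:
  fixes A :: "'s \<Rightarrow> 'j \<Rightarrow> real"
  assumes "finite S" "finite J" "card S < card J"
  shows "\<exists>h. (\<exists>j\<in>J. h j \<noteq> 0) \<and> (\<forall>s\<in>S. (\<Sum>j\<in>J. h j * A s j) = 0)"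
  using assms
proof (induction S arbitrary: J A rule: finite_induct)
  case empty
  then have "J \<noteq> {}" by auto
  then show ?case by (intro exI[of _ "\<lambda>_. 1"]) auto
next
  case (insert s S)
  show ?case
  proof (cases "\<forall>j\<in>J. A s j = 0")
    case True
    have "card S < card J" using insert by simp
    then obtain h where "\<exists>j\<in>J. h j \<noteq> 0" "\<forall>t\<in>S. (\<Sum>j\<in>J. h j * A t j) = 0"
      using insert.IH[of J A] insert.prems by blast
    then show ?thesis using True by (intro exI[of _ h]) simp
  next
    case False
    then obtain p where p: "p \<in> J" "A s p \<noteq> 0" by blast
    define J' where "J' = J - {p}"
    have J': "finite J'" "card S < card J'" "p \<notin> J'" "J = insert p J'"
      using insert p by (auto simp: J'_def)
    define A' where "A' t j = A t j - A t p / A s p * A s j" for t j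
    obtain h where h: "\<exists>j\<in>J'. h j \<noteq> 0" "\<forall>t\<in>S. (\<Sum>j\<in>J'. h j * A' t j) = 0"
      using insert.IH[of J' A'] J' by blast
    define k where "k = (\<Sum>j\<in>J'. h j * A s j)"
    define g where "g = h(p := - k / A s p)"
    have gs: "(\<Sum>j\<in>J. g j * A t j) = (- k / A s p) * A t p + (\<Sum>j\<in>J'. h j * A t j)" for t
    proof -
      have "(\<Sum>j\<in>J'. g j * A t j) = (\<Sum>j\<in>J'. h j * A t j)"
        using J'(3) by (intro sum.cong) (auto simp: g_def)
      then show ?thesis using J'(1,3) unfolding J'(4) by (simp add: g_def)
    qed
    have "(\<Sum>j\<in>J. g j * A s j) = 0" unfolding gs using p(2) by (simp add: k_def)
    moreover have "(\<Sum>j\<in>J. g j * A t j) = 0" if "t \<in> S" for t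
    proof -
      have "0 = (\<Sum>j\<in>J'. h j * A' t j)" using h(2) that by simp
      also have "\<dots> = (\<Sum>j\<in>J'. h j * A t j) - A t p / A s p * k"
        unfolding A'_def k_def by (simp add: right_diff_distrib sum_subtractf sum_distrib_left algebra_simps)
      finally show ?thesis unfolding gs by simp
    qed
    moreover have "\<exists>j\<in>J. g j \<noteq> 0" using h(1) J' by (auto simp: g_def)
    ultimately show ?thesis by (intro exI[of _ g]) auto
  qed
qed

text \<open>Along a moment curve with distinct positive exponents a nonzero affine functional
  becomes a nonzero polynomial in the parameter: the \<open>h j\<close> are its coefficients at
  \<open>e j\<close>, and if all vanish, it is the constant \<open>a\<close>.\<close>

lemma finite_zeros_moment_perturbation:
  fixes h q :: "'j \<Rightarrow> real" and a :: real and e :: "'j \<Rightarrow> nat"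
  assumes "finite J" "inj_on e J" "\<And>j. j \<in> J \<Longrightarrow> e j > 0" "a \<noteq> 0 \<or> (\<exists>j\<in>J. h j \<noteq> 0)"
  shows "finite {\<tau>. a + (\<Sum>j\<in>J. h j * (q j + \<tau> ^ e j)) = 0}"
proof -
  define p where "p = [:a + (\<Sum>j\<in>J. h j * q j):] + (\<Sum>j\<in>J. monom (h j) (e j))"
  have poly: "poly p \<tau> = a + (\<Sum>j\<in>J. h j * (q j + \<tau> ^ e j))" for \<tau>
    by (simp add: p_def poly_sum poly_monom distrib_left sum.distrib)
  have ce: "coeff p (e j) = h j" if "j \<in> J" for j
  proof -
    have "coeff [:c:] (e j) = 0" for c :: real using assms(3)[OF that] by (cases "e j") auto
    then have "coeff p (e j) = (\<Sum>i\<in>J. if e i = e j then h i else 0)"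
      by (simp add: p_def coeff_sum)
    also have "\<dots> = (\<Sum>i\<in>J. if i = j then h i else 0)"
      by (rule sum.cong[OF refl]) (simp add: inj_on_eq_iff[OF assms(2) _ that])
    also have "\<dots> = h j" using assms(1) that by simp
    finally show ?thesis .
  qed
  have "p \<noteq> 0"
  proof (cases "\<exists>j\<in>J. h j \<noteq> 0")
    case True
    then show ?thesis using ce by force
  next
    case False
    then have "poly p 0 = a" unfolding poly by simp
    then show ?thesis using assms(4) False by auto
  qed
  then show ?thesis using poly_roots_finite[of p] unfolding poly by simp
qed

text \<open>General position of the points \<open>p v\<close> in the space with coordinates
  \<open>J\<close>: any \<open>card J + 1\<close> or fewer of them are affinely independent. Phrased
  through coefficients on all of \<open>\<V>\<close> with small support, the form in which
  differences of two partitions of unity arrive.\<close>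

definition affinely_generic :: "'j set \<Rightarrow> 'v set \<Rightarrow> ('v \<Rightarrow> 'j \<Rightarrow> real) \<Rightarrow> bool" where
  "affinely_generic J \<V> p \<longleftrightarrow> (\<forall>l. (\<Sum>v\<in>\<V>. l v) = 0 \<longrightarrow> (\<forall>j\<in>J. (\<Sum>v\<in>\<V>. l v * p v j) = 0) \<longrightarrow>
      card {v\<in>\<V>. l v \<noteq> 0} \<le> card J + 1 \<longrightarrow> (\<forall>v\<in>\<V>. l v = 0))"

text \<open>Points are placed one at a time. The new one has to avoid the zero sets of finitely many
  affine functionals, one vanishing on each set of at most \<open>card J\<close> old points; a
  perturbation along a moment curve meets them for finitely many parameters only.\<close>

lemma generic_points:
  fixes q :: "'v \<Rightarrow> 'j \<Rightarrow> real" and \<eta> :: real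
  assumes "finite \<V>" "finite J" "0 < \<eta>" "\<eta> < 1"
    and q: "\<And>v j. v \<in> \<V> \<Longrightarrow> j \<in> J \<Longrightarrow> 0 \<le> q v j \<and> q v j \<le> 1"
  shows "\<exists>p. (\<forall>v\<in>\<V>. \<forall>j\<in>J. 0 \<le> p v j \<and> p v j \<le> 1 \<and> \<bar>p v j - q v j\<bar> \<le> \<eta>) \<and>
    affinely_generic J \<V> p"
  using assms(1) q
proof (induction \<V> rule: finite_induct)
  case empty
  then show ?case by (simp add: affinely_generic_def)
next
  case (insert v \<V>)
  have "\<exists>p. (\<forall>v\<in>\<V>. \<forall>j\<in>J. 0 \<le> p v j \<and> p v j \<le> 1 \<and> \<bar>p v j - q v j\<bar> \<le> \<eta>) \<and> affinely_generic J \<V> p"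
    by (rule insert.IH) (use insert.prems in simp)
  then obtain p where p: "\<forall>v\<in>\<V>. \<forall>j\<in>J. 0 \<le> p v j \<and> p v j \<le> 1 \<and> \<bar>p v j - q v j\<bar> \<le> \<eta>"
    and gen: "affinely_generic J \<V> p" by blast
  \<comment> \<open>An affine functional has \<open>card J + 1\<close> coefficients,
    \<open>None\<close> standing for the constant term, and vanishing on \<open>S\<close> imposes at
    most \<open>card J\<close> equations.\<close>
  have "\<exists>g. (g None \<noteq> 0 \<or> (\<exists>j\<in>J. g (Some j) \<noteq> 0)) \<and> (\<forall>s\<in>S. g None + (\<Sum>j\<in>J. g (Some j) * p s j) = 0)"
    if S: "S \<subseteq> \<V>" "card S \<le> card J" for S
  proof -
    have "finite S" using S(1) insert(1) by (rule finite_subset)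
    moreover have "finite (insert None (Some ` J))" using assms(2) by simp
    moreover have "card S < card (insert None (Some ` J))"
      using assms(2) S(2) by (simp add: card_image)
    ultimately have "\<exists>g. (\<exists>j\<in>insert None (Some ` J). g j \<noteq> 0) \<and>
      (\<forall>s\<in>S. (\<Sum>j\<in>insert None (Some ` J). g j * (case j of None \<Rightarrow> 1 | Some i \<Rightarrow> p s i)) = 0)"
      by (rule homogeneous_system_nontrivial)
    then show ?thesis using assms(2) by (simp add: sum.reindex)
  qed
  then have "\<forall>S. \<exists>g. S \<subseteq> \<V> \<and> card S \<le> card J \<longrightarrow>
      (g None \<noteq> 0 \<or> (\<exists>j\<in>J. g (Some j) \<noteq> 0)) \<and> (\<forall>s\<in>S. g None + (\<Sum>j\<in>J. g (Some j) * p s j) = 0)"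
    by simp
  from choice[OF this] obtain g where g: "\<forall>S. S \<subseteq> \<V> \<and> card S \<le> card J \<longrightarrow>
      (g S None \<noteq> 0 \<or> (\<exists>j\<in>J. g S (Some j) \<noteq> 0)) \<and> (\<forall>s\<in>S. g S None + (\<Sum>j\<in>J. g S (Some j) * p s j) = 0)" ..
  define a h where "a S = g S None" and "h S j = g S (Some j)" for S j
  have ah: "(a S \<noteq> 0 \<or> (\<exists>j\<in>J. h S j \<noteq> 0)) \<and> (\<forall>s\<in>S. a S + (\<Sum>j\<in>J. h S j * p s j) = 0)"
    if "S \<subseteq> \<V>" "card S \<le> card J" for S
    unfolding a_def h_def using g that by blast
  obtain e0 where e0: "bij_betw e0 J {0..<card J}" using ex_bij_betw_finite_nat[OF assms(2)] by blast
  define e where "e j = Suc (e0 j)" for j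
  have e: "inj_on e J" "\<And>j. e j > 0" using e0 by (auto simp: e_def inj_on_def bij_betw_def)
  \<comment> \<open>Contracting by 1 - \<eta> makes room for adding powers of \<open>\<tau>\<close>
    < \<eta> without leaving [0,1]; the contraction lowers and the powers raise the value by at most
    \<eta>, so the total change is also at most \<eta>.\<close>
  define q' where "q' j = (1 - \<eta>) * q v j" for j
  define Bad where "Bad = (\<Union>S\<in>{S\<in>Pow \<V>. card S \<le> card J}. {\<tau>. a S + (\<Sum>j\<in>J. h S j * (q' j + \<tau> ^ e j)) = 0})"
  have "finite Bad" unfolding Bad_def
  proof (rule finite_UN_I)
    show "finite {S\<in>Pow \<V>. card S \<le> card J}" using insert(1) by simp
    show "finite {\<tau>. a S + (\<Sum>j\<in>J. h S j * (q' j + \<tau> ^ e j)) = 0}" if "S \<in> {S\<in>Pow \<V>. card S \<le> card J}" for S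
      by (rule finite_zeros_moment_perturbation[OF assms(2) e]) (use ah that in blast)
  qed
  then have "infinite ({0<..<\<eta>} - Bad)" using assms(3) by (simp add: infinite_Ioo)
  then have "{0<..<\<eta>} - Bad \<noteq> {}" by (metis finite.emptyI)
  then obtain \<tau> where "\<tau> \<in> {0<..<\<eta>} - Bad" by blast
  then have \<tau>: "0 < \<tau>" "\<tau> < \<eta>" "\<tau> \<notin> Bad" by simp_all
  define pv where "pv j = q' j + \<tau> ^ e j" for j
  define p' where "p' = p(v := pv)"
  have p'V: "p' w = p w" if "w \<in> \<V>" for w using that insert(2) by (auto simp: p'_def)
  show ?case
    unfolding affinely_generic_def
  proof (intro exI[of _ p'] conjI ballI allI impI)
    fix w j assume w: "w \<in> insert v \<V>" and j: "j \<in> J"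
    have *: "0 \<le> p' w j \<and> p' w j \<le> 1 \<and> \<bar>p' w j - q w j\<bar> \<le> \<eta>"
    proof (cases "w = v")
      case True
      have \<tau>e: "0 < \<tau> ^ e j" "\<tau> ^ e j \<le> \<tau>"
        using \<tau> assms(4) power_decreasing[of 1 "e j" \<tau>] e(2)[of j] by auto
      have qv: "0 \<le> q v j" "q v j \<le> 1" using insert.prems[of v j] j by auto
      have "\<eta> * q v j \<le> \<eta>" "0 \<le> \<eta> * q v j" using qv assms(3) by (simp_all add: mult_left_le)
      moreover have "0 \<le> (1 - \<eta>) * q v j" "(1 - \<eta>) * q v j \<le> 1 - \<eta>"
        using qv assms(4) by (simp_all add: mult_left_le)
      moreover have "p' w j = (1 - \<eta>) * q v j + \<tau> ^ e j" using True by (simp add: p'_def pv_def q'_def)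
      moreover have "(1 - \<eta>) * q v j = q v j - \<eta> * q v j" by (simp add: algebra_simps)
      moreover have "q w j = q v j" using True by simp
      ultimately show ?thesis using \<tau>(1,2) \<tau>e unfolding abs_le_iff by linarith
    next
      case False
      then show ?thesis using w p j p'V by simp
    qed
    show "0 \<le> p' w j" "p' w j \<le> 1" "\<bar>p' w j - q w j\<bar> \<le> \<eta>" using * by auto
  next
    fix l :: "'v \<Rightarrow> real" and w
    assume l: "(\<Sum>v\<in>insert v \<V>. l v) = 0" "\<forall>j\<in>J. (\<Sum>v\<in>insert v \<V>. l v * p' v j) = 0"
      "card {u \<in> insert v \<V>. l u \<noteq> 0} \<le> card J + 1" and w: "w \<in> insert v \<V>"
    have l2: "l v * pv j + (\<Sum>u\<in>\<V>. l u * p u j) = 0" if "j \<in> J" for j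
    proof -
      have "(\<Sum>u\<in>\<V>. l u * p' u j) = (\<Sum>u\<in>\<V>. l u * p u j)" using p'V by (intro sum.cong) auto
      moreover have "l v * p' v j + (\<Sum>u\<in>\<V>. l u * p' u j) = 0"
        using bspec[OF l(2) that] insert(1,2) by simp
      ultimately show ?thesis by (simp add: p'_def)
    qed
    have l1: "l v + (\<Sum>u\<in>\<V>. l u) = 0" using l(1) insert(1,2) by simp
    have lv: "l v = 0"
    proof (rule ccontr)
      assume lv: "l v \<noteq> 0"
      define S where "S = {u\<in>\<V>. l u \<noteq> 0}"
      have "{u \<in> insert v \<V>. l u \<noteq> 0} = insert v S" using lv by (auto simp: S_def)
      then have cS: "S \<subseteq> \<V>" "card S \<le> card J" using l(3) insert(1,2) by (auto simp: S_def)
      have z: "l u * (a S + (\<Sum>j\<in>J. h S j * p u j)) = 0" if "u \<in> \<V>" for u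
        using ah[OF cS] that by (cases "u \<in> S") (auto simp: S_def)
      \<comment> \<open>The functional belonging to the other points in the relation is applied to
        the relation: all old terms vanish, so a nonzero \<open>l v\<close> would put the new point
        in its zero set.\<close>
      have "l v * (a S + (\<Sum>j\<in>J. h S j * pv j))
        = l v * (a S + (\<Sum>j\<in>J. h S j * pv j)) + (\<Sum>u\<in>\<V>. l u * (a S + (\<Sum>j\<in>J. h S j * p u j)))"
      proof -
        have "(\<Sum>u\<in>\<V>. l u * (a S + (\<Sum>j\<in>J. h S j * p u j))) = 0"
          by (intro sum.neutral ballI z)
        then show ?thesis by simp
      qed
      also have "\<dots> = a S * (l v + (\<Sum>u\<in>\<V>. l u)) + (\<Sum>j\<in>J. h S j * (l v * pv j + (\<Sum>u\<in>\<V>. l u * p u j)))"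
      proof -
        have "(\<Sum>u\<in>\<V>. l u * (\<Sum>j\<in>J. h S j * p u j)) = (\<Sum>j\<in>J. h S j * (\<Sum>u\<in>\<V>. l u * p u j))"
          unfolding sum_distrib_left by (subst sum.swap) (simp add: mult_ac)
        then show ?thesis
          by (simp add: distrib_left sum.distrib sum_distrib_left mult_ac)
      qed
      also have "\<dots> = 0" using l1 l2 by simp
      finally have "a S + (\<Sum>j\<in>J. h S j * pv j) = 0" using lv by simp
      then have "\<tau> \<in> Bad" using cS unfolding Bad_def pv_def by blast
      then show False using \<tau>(3) by simp
    qed
    have "l u = 0" if "u \<in> \<V>" for u
    proof (rule gen[unfolded affinely_generic_def, rule_format, OF _ _ _ that])
      show "(\<Sum>u\<in>\<V>. l u) = 0" using l1 lv by simp
      show "(\<Sum>u\<in>\<V>. l u * p u j) = 0" if "j \<in> J" for j using l2[OF that] lv by simp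
      have "{u\<in>\<V>. l u \<noteq> 0} = {u \<in> insert v \<V>. l u \<noteq> 0}" using lv by auto
      then show "card {u\<in>\<V>. l u \<noteq> 0} \<le> card J + 1" using l(3) by simp
    qed
    then show "l w = 0" using w lv by auto
  qed
qed

section \<open>Perturbation along towers\<close>

text \<open>Combining with the trivial family \<open>{UNIV}\<close> in every colour, of dimension 0,
  turns a coloured family into a cover without raising the dimension.\<close>

lemma fine_map_imp_fine_cover:
  fixes P :: "'a::metric_space \<Rightarrow> 'a \<Rightarrow> bool"
  assumes "compact (UNIV :: 'a set)" "open {p. P (fst p) (snd p)}" "fine_map P m"
  shows "\<exists>\<W>. fine_cover P m \<W>"
proof -
  obtain \<U> where U: "coloured_family P m (m + 0 + 1) \<U>"
    using fine_map_imp_coloured_family[OF assms] by blast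
  have "coloured_family (\<lambda>_ _ :: 'a. True) 0 (m + 0 + 1) (\<lambda>_. {UNIV})"
    by (simp add: coloured_family_def)
  from coloured_families_imp_fine_cover[OF U this, of P] show ?thesis by simp
qed

text \<open>\<open>G n x\<close> is the value intended for the point \<open>T n x\<close>: a
  partition of unity blends generic points near the sampled values of \<open>f\<close>. One \<eta>
  in the error comes from sampling, one from making the points generic.\<close>

lemma fine_cover_imp_affine_encoding:
  fixes T :: "int^'k \<Rightarrow> 'a::metric_space \<Rightarrow> 'a" and f :: "'a \<Rightarrow> real^'d"
  assumes W: "finite W" "W \<subseteq> W'" and cov: "fine_cover (orbit_close T W' \<epsilon>) m \<V>"
    and m: "2 * m < CARD('d) * card W"
    and f: "\<And>x. f x \<in> unit_cube" "\<And>x y i. dist x y < \<epsilon> \<Longrightarrow> \<bar>f x $ i - f y $ i\<bar> \<le> \<eta>"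
    and \<eta>: "0 < \<eta>" "\<eta> < 1"
  shows "\<exists>G :: int^'k \<Rightarrow> 'a \<Rightarrow> real^'d. \<forall>n\<in>W. continuous_on UNIV (G n) \<and>
    (\<forall>x. G n x \<in> unit_cube \<and> (\<forall>i. \<bar>G n x $ i - f (T n x) $ i\<bar> \<le> 2 * \<eta>)) \<and>
    (\<forall>x y. (\<forall>n\<in>W. G n x = G n y) \<longrightarrow> orbit_close T W' \<epsilon> x y)"
proof -
  have fin: "finite \<V>" and op: "\<And>V. V \<in> \<V> \<Longrightarrow> open V" and UN: "\<Union>\<V> = UNIV"
    and close: "\<And>V x y. V \<in> \<V> \<Longrightarrow> x \<in> V \<Longrightarrow> y \<in> V \<Longrightarrow> orbit_close T W' \<epsilon> x y"
    and ord: "\<And>x. card {V\<in>\<V>. x \<in> V} \<le> m + 1"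
    using cov unfolding fine_cover_def by blast+
  obtain t where t: "\<And>V. V \<in> \<V> \<Longrightarrow> continuous_on UNIV (t V)"
    "\<And>V x. V \<in> \<V> \<Longrightarrow> 0 \<le> t V x" "\<And>V x. V \<in> \<V> \<Longrightarrow> t V x \<noteq> 0 \<longleftrightarrow> x \<in> V"
    "\<And>x. (\<Sum>V\<in>\<V>. t V x) = (1::real)"
    using open_cover_partition_of_unity[OF fin op UN] by blast
  define J where "J = W \<times> (UNIV :: 'd set)"
  have J: "finite J" "card J = CARD('d) * card W"
    using W by (simp_all add: J_def card_cartesian_product)
  \<comment> \<open>For an empty \<open>V\<close> the sample is arbitrary, but there the partition
    function vanishes.\<close>
  define c where "c V = (SOME x. x \<in> V)" for V :: "'a set"
  have c: "c V \<in> V" if "x \<in> V" for x V using that unfolding c_def by (rule someI)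
  define q where "q V j = f (T (fst j) (c V)) $ snd j" for V j
  have "0 \<le> q V j \<and> q V j \<le> 1" for V j using f(1) by (simp add: q_def unit_cube_def)
  then obtain p where p: "\<forall>V\<in>\<V>. \<forall>j\<in>J. 0 \<le> p V j \<and> p V j \<le> 1 \<and> \<bar>p V j - q V j\<bar> \<le> \<eta>"
    and gen: "affinely_generic J \<V> p"
    using generic_points[OF fin J(1) \<eta>, of q] by metis
  define G :: "int^'k \<Rightarrow> 'a \<Rightarrow> real^'d" where "G n x = (\<chi> i. \<Sum>V\<in>\<V>. t V x * p V (n, i))" for n x
  have cont: "continuous_on UNIV (G n)" for n
    unfolding G_def by (intro continuous_on_vec_lambda continuous_intros t(1))
  have cube: "G n x \<in> unit_cube" if "n \<in> W" for n x
  proof -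
    have "0 \<le> (\<Sum>V\<in>\<V>. t V x * p V (n, i)) \<and> (\<Sum>V\<in>\<V>. t V x * p V (n, i)) \<le> 1" for i
    proof
      have j: "(n, i) \<in> J" using that by (simp add: J_def)
      show "0 \<le> (\<Sum>V\<in>\<V>. t V x * p V (n, i))"
        using t(2) p j by (intro sum_nonneg mult_nonneg_nonneg) blast+
      have "(\<Sum>V\<in>\<V>. t V x * p V (n, i)) \<le> (\<Sum>V\<in>\<V>. t V x)"
        using t(2) p j by (intro sum_mono mult_left_le) blast+
      then show "(\<Sum>V\<in>\<V>. t V x * p V (n, i)) \<le> 1" by (simp only: t(4))
    qed
    then show ?thesis by (simp add: G_def unit_cube_def)
  qed
  have near: "\<bar>G n x $ i - f (T n x) $ i\<bar> \<le> 2 * \<eta>" if n: "n \<in> W" for n x i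
  proof -
    have b: "\<bar>t V x * (p V (n, i) - f (T n x) $ i)\<bar> \<le> t V x * (2 * \<eta>)" if V: "V \<in> \<V>" for V
    proof (cases "x \<in> V")
      case False
      then have "t V x = 0" using t(3)[OF V] by blast
      then show ?thesis by simp
    next
      case True
      have "orbit_close T W' \<epsilon> (c V) x" by (rule close[OF V c[OF True] True])
      then have "dist (T n (c V)) (T n x) < \<epsilon>" using n W(2) unfolding orbit_close_def by blast
      then have "\<bar>q V (n, i) - f (T n x) $ i\<bar> \<le> \<eta>" unfolding q_def fst_conv snd_conv by (rule f(2))
      moreover have "\<bar>p V (n, i) - q V (n, i)\<bar> \<le> \<eta>" using p V n by (simp add: J_def)
      ultimately have "\<bar>p V (n, i) - f (T n x) $ i\<bar> \<le> 2 * \<eta>" by linarith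
      then show ?thesis using t(2)[OF V, of x] by (simp add: abs_mult mult_left_mono)
    qed
    have "G n x $ i - f (T n x) $ i = (\<Sum>V\<in>\<V>. t V x * p V (n, i)) - (\<Sum>V\<in>\<V>. t V x) * f (T n x) $ i"
      by (simp add: G_def t(4))
    also have "\<dots> = (\<Sum>V\<in>\<V>. t V x * (p V (n, i) - f (T n x) $ i))"
      by (simp add: right_diff_distrib sum_subtractf sum_distrib_right)
    finally have "\<bar>G n x $ i - f (T n x) $ i\<bar> \<le> (\<Sum>V\<in>\<V>. \<bar>t V x * (p V (n, i) - f (T n x) $ i)\<bar>)"
      by (simp add: sum_abs)
    also have "\<dots> \<le> (\<Sum>V\<in>\<V>. t V x * (2 * \<eta>))" by (rule sum_mono) (rule b)
    also have "\<dots> = 2 * \<eta>" unfolding sum_distrib_right[symmetric] t(4) by simp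
    finally show ?thesis .
  qed
  have inj: "orbit_close T W' \<epsilon> x y" if eq: "\<forall>n\<in>W. G n x = G n y" for x y
  proof -
    \<comment> \<open>Equal encodings make \<open>l\<close> an affine relation supported on the sets
      containing \<open>x\<close> or \<open>y\<close>, at most 2 m + 2 of them; as 2 m <
      \<open>card J\<close>, this is at most \<open>card J + 1\<close>, so \<open>l\<close> vanishes
      and both points lie in the same sets.\<close>
    define l where "l V = t V x - t V y" for V
    have "l V = 0" if V: "V \<in> \<V>" for V
    proof (rule gen[unfolded affinely_generic_def, rule_format, OF _ _ _ V])
      show "(\<Sum>V\<in>\<V>. l V) = 0" by (simp add: l_def sum_subtractf t(4))
      show "(\<Sum>V\<in>\<V>. l V * p V j) = 0" if "j \<in> J" for j
      proof -
        obtain n i where j: "j = (n, i)" by (cases j)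
        then have "G n x $ i = G n y $ i" using eq that by (simp add: J_def)
        then show ?thesis by (simp add: G_def l_def j left_diff_distrib sum_subtractf)
      qed
      have "{V \<in> \<V>. l V \<noteq> 0} \<subseteq> {V\<in>\<V>. x \<in> V} \<union> {V\<in>\<V>. y \<in> V}"
      proof (intro subsetI)
        fix V assume V: "V \<in> {V \<in> \<V>. l V \<noteq> 0}"
        then have "t V x \<noteq> 0 \<or> t V y \<noteq> 0" by (auto simp: l_def)
        then show "V \<in> {V\<in>\<V>. x \<in> V} \<union> {V\<in>\<V>. y \<in> V}" using t(3) V by blast
      qed
      then have "card {V \<in> \<V>. l V \<noteq> 0} \<le> card ({V\<in>\<V>. x \<in> V} \<union> {V\<in>\<V>. y \<in> V})"
        using fin by (intro card_mono) auto
      also have "\<dots> \<le> card {V\<in>\<V>. x \<in> V} + card {V\<in>\<V>. y \<in> V}" by (rule card_Un_le)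
      finally show "card {V \<in> \<V>. l V \<noteq> 0} \<le> card J + 1" using ord[of x] ord[of y] m J(2) by linarith
    qed
    then have same: "t V x = t V y" if "V \<in> \<V>" for V using that by (simp add: l_def)
    have "x \<in> \<Union>\<V>" using UN by simp
    then obtain V where V: "V \<in> \<V>" "x \<in> V" by blast
    then have "t V y \<noteq> 0" using same[OF V(1)] t(3)[OF V(1), of x] by simp
    then have "y \<in> V" using t(3)[OF V(1)] by blast
    then show ?thesis using close V by blast
  qed
  show ?thesis using cont cube near inj by (intro exI[of _ G]) blast
qed

lemma continuous_on_If_clopen:
  assumes "open K" "closed K" "continuous_on UNIV h"
  shows "continuous_on UNIV (\<lambda>x. if x \<in> K then h x else (0 :: 'b::real_normed_vector))"
proof -
  have "continuous_on (K \<union> - K) (\<lambda>x. if x \<in> K then h x else 0)"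
    using assms by (intro continuous_on_If) (auto intro: continuous_on_subset)
  then show ?thesis by simp
qed

lemma norm_le_of_components:
  fixes x :: "real^'d" and b :: real
  assumes "\<And>i. \<bar>x $ i\<bar> \<le> b"
  shows "norm x \<le> CARD('d) * b"
proof -
  have "(\<Sum>i\<in>UNIV. \<bar>x $ i\<bar>) \<le> CARD('d) * b" by (rule sum_bounded_above) (rule assms)
  then show ?thesis using norm_le_l1_cart[of x] by linarith
qed

text \<open>Density at a single scale. Two points with the same image in Z occupy the same position
  over the same base, so equal values of \<open>g\<close> along their orbits include equal encodings
  of their base points.\<close>

lemma extension_perturbation:
  fixes T :: "int^'k \<Rightarrow> 'a::metric_space \<Rightarrow> 'a" and S :: "int^'k \<Rightarrow> 'z::metric_space \<Rightarrow> 'z"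
    and f :: "'a \<Rightarrow> real^'d"
  assumes S: "dyn_system S" "aperiodic S" "zero_dimensional_space TYPE('z)"
    and T: "dyn_system T" and ext: "extension T S \<pi>"
    and md: "mdim T < ereal (real CARD('d) / 2)"
    and f: "continuous_on UNIV f" "\<And>x. f x \<in> unit_cube" and "\<epsilon> > 0" "\<delta> > 0"
  obtains g where "continuous_on UNIV g" "\<And>x. g x \<in> unit_cube" "\<And>x. norm (g x - f x) \<le> \<delta>"
    "\<And>x y. \<pi> x = \<pi> y \<Longrightarrow> (\<And>n. g (T n x) = g (T n y)) \<Longrightarrow> dist x y < \<epsilon>"
proof -
  have zkS: "zk_action S" using S(1) by (simp add: dyn_system_def)
  have zkT: "zk_action T" and cX: "compact (UNIV :: 'a set)" using T by (auto simp: dyn_system_def)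
  have \<pi>c: "continuous_on UNIV \<pi>" and \<pi>T: "\<And>n x. \<pi> (T n x) = S n (\<pi> x)"
    using ext by (auto simp: extension_def)
  have TT: "T (- n) (T n x) = x" "T n (T (- n) x) = x" and SS: "S (- n) (S n z) = z" for n x z
    by (simp_all add: zk_action_comp[OF zkT] zk_action_0[OF zkT] zk_action_comp[OF zkS] zk_action_0[OF zkS])
  define D where "D = real CARD('d)"
  have D: "D \<ge> 1" using zero_less_card_finite[where 'a='d] unfolding D_def by linarith
  \<comment> \<open>The coordinates of \<open>g - f\<close> are bounded by 2 \<eta>, its norm by D
    times that. The bound 1/2 keeps \<eta> below 1, as generic placement requires.\<close>
  define \<eta> where "\<eta> = min (1/2) (\<delta> / (2 * D))"
  have \<eta>: "0 < \<eta>" "\<eta> < 1" and "\<eta> \<le> \<delta> / (2 * D)" using \<open>\<delta> > 0\<close> D by (auto simp: \<eta>_def)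
  then have D\<eta>: "D * (2 * \<eta>) \<le> \<delta>" using D by (simp add: field_simps)
  have "uniformly_continuous_on UNIV f" by (rule compact_uniformly_continuous[OF f(1) cX])
  then obtain e where e: "e > 0" "\<And>x y. dist x y < e \<Longrightarrow> dist (f x) (f y) < \<eta>"
    unfolding uniformly_continuous_on_def using \<eta>(1) by (metis UNIV_I)
  define \<epsilon>' where "\<epsilon>' = min e \<epsilon>"
  have \<epsilon>': "\<epsilon>' > 0" "\<epsilon>' \<le> \<epsilon>" using e(1) \<open>\<epsilon> > 0\<close> by (auto simp: \<epsilon>'_def)
  have modulus: "\<bar>f x $ i - f y $ i\<bar> \<le> \<eta>" if "dist x y < \<epsilon>'" for x y i
  proof -
    have "dist (f x) (f y) < \<eta>" using e(2) that by (simp add: \<epsilon>'_def)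
    moreover have "\<bar>f x $ i - f y $ i\<bar> \<le> dist (f x) (f y)"
      using component_le_norm_cart[of "f x - f y" i] by (simp add: dist_norm)
    ultimately show ?thesis by linarith
  qed
  obtain N where N: "N \<ge> 1" "real (widim (dOmega T (Defs.box N)) \<epsilon>') < D / 2 * real N ^ CARD('k)"
    using mdim_less_imp_widim_less[OF T md \<epsilon>'(1)] unfolding D_def by blast
  define w where "w = widim (dOmega T (Defs.box N)) \<epsilon>'"
  define C where "C = D / 2 * real N ^ CARD('k)"
  have C: "C > 0" "real w < C" using N D by (auto simp: C_def w_def)
  then have "real w / C < 1" by simp
  \<comment> \<open>The slack in mdim < D/2 at this box size; it is spent on the ratio between the
    open cell and the boxes covering the closed one.\<close>
  then obtain \<theta> where \<theta>: "real w / C < \<theta>" "\<theta> < 1" using dense by blast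
  have "0 \<le> real w / C" using C by simp
  then have \<theta>0: "0 < \<theta>" using \<theta>(1) by linarith
  have w\<theta>: "real w < \<theta> * C" using \<theta>(1) C(1) by (simp add: divide_less_eq)
  obtain I :: "(int^'k) set set" and U W W' A where I: "finite I"
    and U: "\<And>P. P \<in> I \<Longrightarrow> open (U P)" "\<And>P. P \<in> I \<Longrightarrow> closed (U P)"
    and W: "\<And>P. P \<in> I \<Longrightarrow> finite (W P)" "\<And>P. P \<in> I \<Longrightarrow> 0 \<in> W P" "\<And>P. P \<in> I \<Longrightarrow> W P \<subseteq> W' P"
    and A: "\<And>P. P \<in> I \<Longrightarrow> finite (A P)" "\<And>P. P \<in> I \<Longrightarrow> W' P \<subseteq> (\<Union>a\<in>A P. (\<lambda>n. n + a) ` Defs.box N)"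
      "\<And>P. P \<in> I \<Longrightarrow> \<theta> * real (card (A P) * N ^ CARD('k)) \<le> card (W P)"
    and dis: "\<And>P Q n m y y'. P \<in> I \<Longrightarrow> Q \<in> I \<Longrightarrow> n \<in> W P \<Longrightarrow> m \<in> W Q \<Longrightarrow> y \<in> U P \<Longrightarrow> y' \<in> U Q \<Longrightarrow>
       S n y = S m y' \<Longrightarrow> P = Q \<and> n = m"
    and cover: "\<And>z. \<exists>P\<in>I. \<exists>n\<in>W' P. \<exists>y\<in>U P. z = S n y"
    by (rule clopen_towers[OF S \<theta>0 \<theta>(2) N(1)]; rule that; assumption)
  have "\<exists>G :: int^'k \<Rightarrow> 'a \<Rightarrow> real^'d. \<forall>n\<in>W P. continuous_on UNIV (G n) \<and>
    (\<forall>x. G n x \<in> unit_cube \<and> (\<forall>i. \<bar>G n x $ i - f (T n x) $ i\<bar> \<le> 2 * \<eta>)) \<and>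
    (\<forall>x y. (\<forall>n\<in>W P. G n x = G n y) \<longrightarrow> orbit_close T (W' P) \<epsilon>' x y)" if P: "P \<in> I" for P
  proof -
    have "Defs.box N \<noteq> ({} :: (int^'k) set)" using box_nonempty[OF N(1)] by blast
    then have "fine_map (orbit_close T (Defs.box N) \<epsilon>') w"
      unfolding w_def by (rule fine_map_widim[OF cX zkT finite_box _ \<epsilon>'(1)])
    then have "fine_map (orbit_close T (\<Union>a\<in>A P. (\<lambda>n. n + a) ` Defs.box N) \<epsilon>') (card (A P) * w)"
      by (rule fine_map_Union_shifts[OF cX zkT finite_box _ A(1)[OF P]])
    then have "fine_map (orbit_close T (W' P) \<epsilon>') (card (A P) * w)"
      by (rule fine_map_mono) (rule orbit_close_subset[OF _ A(2)[OF P]])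
    moreover have "finite (W' P)"
      by (rule finite_subset[OF A(2)[OF P]]) (simp add: A(1)[OF P] finite_box)
    ultimately obtain \<V> where \<V>: "fine_cover (orbit_close T (W' P) \<epsilon>') (card (A P) * w) \<V>"
      using fine_map_imp_fine_cover[OF cX open_orbit_close[OF zkT]] by blast
    have "card (W P) > 0" using W(1,2)[OF P] card_gt_0_iff by blast
    have "real (card (A P)) * real w < D / 2 * card (W P)"
    \<comment> \<open>Multiplying \<open>w\<theta>\<close> by \<open>card (A P)\<close> keeps it
      strict only for a nonempty \<open>A P\<close>; otherwise strictness comes from
      \<open>W P\<close> being nonempty.\<close>
    proof (cases "card (A P) = 0")
      case True
      then show ?thesis using \<open>card (W P) > 0\<close> D by simp
    next
      case False
      then have "real (card (A P)) * real w < real (card (A P)) * (\<theta> * C)" using w\<theta> by simp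
      also have "\<dots> = D / 2 * (\<theta> * real (card (A P) * N ^ CARD('k)))" by (simp add: C_def)
      also have "\<dots> \<le> D / 2 * card (W P)" using A(3)[OF P] D by (intro mult_left_mono) auto
      finally show ?thesis .
    qed
    then have "real (2 * (card (A P) * w)) < real (CARD('d) * card (W P))" by (simp add: D_def)
    then have "2 * (card (A P) * w) < CARD('d) * card (W P)" by (simp only: of_nat_less_iff)
    from fine_cover_imp_affine_encoding[where f = f, OF W(1)[OF P] W(3)[OF P] \<V> this f(2) modulus \<eta>]
    show ?thesis .
  qed
  then have "\<forall>P\<in>I. \<exists>G :: int^'k \<Rightarrow> 'a \<Rightarrow> real^'d. \<forall>n\<in>W P. continuous_on UNIV (G n) \<and>
    (\<forall>x. G n x \<in> unit_cube \<and> (\<forall>i. \<bar>G n x $ i - f (T n x) $ i\<bar> \<le> 2 * \<eta>)) \<and>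
    (\<forall>x y. (\<forall>n\<in>W P. G n x = G n y) \<longrightarrow> orbit_close T (W' P) \<epsilon>' x y)" by (rule ballI)
  from bchoice[OF this] obtain G where "\<forall>P\<in>I. \<forall>n\<in>W P. continuous_on UNIV (G P n) \<and>
    (\<forall>x. G P n x \<in> unit_cube \<and> (\<forall>i. \<bar>G P n x $ i - f (T n x) $ i\<bar> \<le> 2 * \<eta>)) \<and>
    (\<forall>x y. (\<forall>n\<in>W P. G P n x = G P n y) \<longrightarrow> orbit_close T (W' P) \<epsilon>' x y)" ..
  then have G: "continuous_on UNIV (G P n)" "G P n x \<in> unit_cube" "\<bar>G P n x $ i - f (T n x) $ i\<bar> \<le> 2 * \<eta>"
    "(\<And>n. n \<in> W P \<Longrightarrow> G P n x = G P n y) \<Longrightarrow> orbit_close T (W' P) \<epsilon>' x y"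
    if "P \<in> I" "n \<in> W P" for P n x y i
    using that by blast+
  define L where "L = Sigma I W"
  have finL: "finite L" unfolding L_def using I W(1) by (rule finite_SigmaI)
  \<comment> \<open>The part of X above level \<open>snd j\<close> of the tower over
    \<open>U (fst j)\<close>; clopen because the base is.\<close>
  define K where "K j = {x. S (- snd j) (\<pi> x) \<in> U (fst j)}" for j
  have Kdis: "j = j'" if j: "j \<in> L" "j' \<in> L" and x: "x \<in> K j" "x \<in> K j'" for j j' x
  proof -
    obtain P n Q m where jj: "j = (P, n)" "j' = (Q, m)" "P \<in> I" "Q \<in> I" "n \<in> W P" "m \<in> W Q"
      using j by (auto simp: L_def)
    have "S n (S (- n) (\<pi> x)) = S m (S (- m) (\<pi> x))"
      by (simp add: zk_action_comp[OF zkS])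
    then have "P = Q \<and> n = m"
      using x by (intro dis[OF jj(3-6)]) (auto simp: K_def jj)
    then show ?thesis by (simp add: jj)
  qed
  have K: "open (K j)" "closed (K j)" if "j \<in> L" for j
  proof -
    have c: "continuous_on UNIV (\<lambda>x. S (- snd j) (\<pi> x))"
      by (rule continuous_on_compose2[OF zk_action_cont[OF zkS] \<pi>c]) auto
    have "K j = (\<lambda>x. S (- snd j) (\<pi> x)) -` U (fst j)" by (auto simp: K_def)
    moreover have "fst j \<in> I" using that by (auto simp: L_def)
    ultimately show "open (K j)" "closed (K j)"
      using U c by (auto intro: open_vimage closed_vimage)
  qed
  define h where "h j x = G (fst j) (snd j) (T (- snd j) x)" for j x
  \<comment> \<open>At most one summand is nonzero, so \<open>g\<close> is \<open>h j\<close> on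
    level \<open>j\<close> and \<open>f\<close> off all levels; written as a sum of clopen cut-offs
    it is continuous term by term.\<close>
  define g where "g x = f x + (\<Sum>j\<in>L. if x \<in> K j then h j x - f x else 0)" for x
  have gK: "g x = h j x" if "j \<in> L" "x \<in> K j" for j x
  proof -
    have "(\<Sum>j\<in>L. if x \<in> K j then h j x - f x else 0) = (\<Sum>i\<in>L. if i = j then h i x - f x else 0)"
      using Kdis that by (intro sum.cong) auto
    then show ?thesis using finL that(1) by (simp add: g_def)
  qed
  have gf: "g x = f x" if "\<And>j. j \<in> L \<Longrightarrow> x \<notin> K j" for x
    using that by (simp add: g_def)
  have hcont: "continuous_on UNIV (h j)" if "j \<in> L" for j
  proof -
    have "fst j \<in> I" "snd j \<in> W (fst j)" using that by (auto simp: L_def)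
    then show ?thesis unfolding h_def[abs_def]
      by (intro continuous_on_compose2[OF G(1) zk_action_cont[OF zkT]]) auto
  qed
  show thesis
  proof (rule that[of g])
    show "continuous_on UNIV g"
      unfolding g_def[abs_def] by (intro continuous_intros f(1) continuous_on_If_clopen K hcont)
    show "g x \<in> unit_cube" for x
    proof (cases "\<exists>j\<in>L. x \<in> K j")
      case True
      then obtain j where j: "j \<in> L" "x \<in> K j" by blast
      then have "fst j \<in> I" "snd j \<in> W (fst j)" by (auto simp: L_def)
      then show ?thesis unfolding gK[OF j] h_def by (rule G(2))
    next
      case False
      then show ?thesis using gf f(2) by simp
    qed
    show "norm (g x - f x) \<le> \<delta>" for x
    proof (cases "\<exists>j\<in>L. x \<in> K j")
      case True
      then obtain j where j: "j \<in> L" "x \<in> K j" by blast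
      then have "fst j \<in> I" "snd j \<in> W (fst j)" by (auto simp: L_def)
      then have "\<bar>h j x $ i - f (T (snd j) (T (- snd j) x)) $ i\<bar> \<le> 2 * \<eta>" for i
        unfolding h_def by (rule G(3))
      then have "\<bar>(g x - f x) $ i\<bar> \<le> 2 * \<eta>" for i using gK[OF j] by (simp add: TT)
      then have "norm (g x - f x) \<le> D * (2 * \<eta>)" unfolding D_def by (rule norm_le_of_components)
      then show ?thesis using D\<eta> by linarith
    next
      case False
      then show ?thesis using gf \<open>\<delta> > 0\<close> by simp
    qed
    fix x y assume \<pi>xy: "\<pi> x = \<pi> y" and gxy: "\<And>n. g (T n x) = g (T n y)"
    \<comment> \<open>The position \<open>n\<close> may lie outside \<open>W P\<close>, where
      \<open>g\<close> need not encode anything. The comparison is therefore made at the base points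
      \<open>x'\<close>, \<open>y'\<close>, and closeness along \<open>W' P\<close> carries it back
      to position \<open>n\<close>.\<close>
    obtain P n u where P: "P \<in> I" "n \<in> W' P" "u \<in> U P" "\<pi> x = S n u" using cover[of "\<pi> x"] by blast
    define x' y' where "x' = T (- n) x" and "y' = T (- n) y"
    have \<pi>': "\<pi> x' = u" "\<pi> y' = u" using P(4) \<pi>xy by (simp_all add: x'_def y'_def \<pi>T SS)
    have enc: "g (T m v) = G P m v" if m: "m \<in> W P" and v: "\<pi> v = u" for m v
    proof -
      have "(P, m) \<in> L" using m P(1) by (simp add: L_def)
      moreover have "T m v \<in> K (P, m)" using v P(3) by (simp add: K_def \<pi>T SS)
      ultimately have "g (T m v) = h (P, m) (T m v)" by (rule gK)
      then show ?thesis by (simp add: h_def TT)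
    qed
    have "orbit_close T (W' P) \<epsilon>' x' y'"
    proof (rule G(4)[OF P(1) W(2)[OF P(1)]])
      fix m assume m: "m \<in> W P"
      have "g (T m x') = g (T m y')"
        using gxy[of "m - n"] by (simp add: x'_def y'_def zk_action_comp[OF zkT])
      then show "G P m x' = G P m y'" using enc[OF m] \<pi>' by simp
    qed
    then have "dist (T n x') (T n y') < \<epsilon>'" using P(2) unfolding orbit_close_def by blast
    then show "dist x y < \<epsilon>" using \<epsilon>'(2) by (simp add: x'_def y'_def TT)
  qed
qed

section \<open>Open dense sets of maps and the Baire argument\<close>

definition fibre_embeddings ::
  "(int^'k \<Rightarrow> 'a::metric_space \<Rightarrow> 'a) \<Rightarrow> ('a \<Rightarrow> 'z) \<Rightarrow> real \<Rightarrow> ('a \<Rightarrow>\<^sub>C (real^'d)) set" where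
  "fibre_embeddings T \<pi> \<epsilon> = {f \<in> topspace CX_top.
     \<forall>x y. \<pi> x = \<pi> y \<longrightarrow> I_map T (apply_bcontfun f) x = I_map T (apply_bcontfun f) y \<longrightarrow> dist x y < \<epsilon>}"

text \<open>Compactness: maps tending to \<open>f\<close>, each identifying two points of a common
  fibre of \<pi> at distance at least \<epsilon>, would yield limit points with the same image in Z,
  identified by \<open>f\<close> and again at distance at least \<epsilon>.\<close>

lemma openin_fibre_embeddings:
  fixes T :: "int^'k \<Rightarrow> 'a::metric_space \<Rightarrow> 'a" and \<pi> :: "'a \<Rightarrow> 'z::metric_space"
  assumes T: "dyn_system T" and \<pi>c: "continuous_on UNIV \<pi>"
  shows "openin (CX_top :: ('a \<Rightarrow>\<^sub>C (real^'d)) topology) (fibre_embeddings T \<pi> \<epsilon>)"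
  unfolding CX_top_def openin_euclidean_subtopology_iff
proof (intro conjI ballI)
  show "fibre_embeddings T \<pi> \<epsilon> \<subseteq> {f :: 'a \<Rightarrow>\<^sub>C (real^'d). \<forall>x. apply_bcontfun f x \<in> unit_cube}"
    by (auto simp: fibre_embeddings_def CX_top_def)
  fix f :: "'a \<Rightarrow>\<^sub>C (real^'d)" assume f: "f \<in> fibre_embeddings T \<pi> \<epsilon>"
  have zkT: "zk_action T" and cX: "compact (UNIV :: 'a set)" using T by (auto simp: dyn_system_def)
  show "\<exists>e>0. \<forall>g\<in>{f. \<forall>x. apply_bcontfun f x \<in> unit_cube}. dist g f < e \<longrightarrow> g \<in> fibre_embeddings T \<pi> \<epsilon>"
  proof (rule ccontr)
    assume no: "\<not> ?thesis"
    have "\<exists>x y. (\<exists>g. dist g f < 1 / real (Suc j) \<and> (\<forall>n. apply_bcontfun g (T n x) = apply_bcontfun g (T n y)))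
      \<and> \<pi> x = \<pi> y \<and> \<epsilon> \<le> dist x y" for j :: nat
    proof -
      have "\<not> (\<forall>g\<in>{f. \<forall>x. apply_bcontfun f x \<in> unit_cube}. dist g f < 1 / real (Suc j) \<longrightarrow> g \<in> fibre_embeddings T \<pi> \<epsilon>)"
        using no by (metis of_nat_0_less_iff zero_less_Suc zero_less_divide_1_iff)
      then obtain g where g: "\<forall>x. apply_bcontfun g x \<in> unit_cube" "dist g f < 1 / real (Suc j)"
        "g \<notin> fibre_embeddings T \<pi> \<epsilon>" by blast
      then show ?thesis
        unfolding fibre_embeddings_def CX_top_def I_map_def by (auto simp: not_less fun_eq_iff)
    qed
    then obtain x y where xy: "\<And>j. \<exists>g. dist g f < 1 / real (Suc j) \<and> (\<forall>n. apply_bcontfun g (T n (x j)) = apply_bcontfun g (T n (y j)))"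
      "\<And>j. \<pi> (x j) = \<pi> (y j)" "\<And>j. \<epsilon> \<le> dist (x j) (y j)"
      by metis
    have "compact (UNIV :: ('a \<times> 'a) set)" using compact_Times[OF cX cX] by simp
    then obtain p r where r: "strict_mono (r :: nat \<Rightarrow> nat)" "((\<lambda>j. (x j, y j)) \<circ> r) \<longlonglongrightarrow> p"
      unfolding compact_def by blast
    have px: "(\<lambda>j. x (r j)) \<longlonglongrightarrow> fst p" and py: "(\<lambda>j. y (r j)) \<longlonglongrightarrow> snd p"
      using tendsto_fst[OF r(2)] tendsto_snd[OF r(2)] by (simp_all add: o_def)
    have lim: "(\<lambda>j. F (z j)) \<longlonglongrightarrow> F l" if "continuous_on UNIV F" "z \<longlonglongrightarrow> l"
      for F :: "'a \<Rightarrow> 'b::topological_space" and z l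
      using continuous_on_tendsto_compose[OF that(1,2)] by simp
    have "\<pi> (fst p) = \<pi> (snd p)"
      using lim[OF \<pi>c px] lim[OF \<pi>c py] unfolding xy(2) by (rule LIMSEQ_unique)
    moreover have "apply_bcontfun f (T n (fst p)) = apply_bcontfun f (T n (snd p))" for n
    proof -
      have fc: "continuous_on UNIV (\<lambda>x. apply_bcontfun f (T n x))"
        by (rule continuous_on_compose2[OF _ zk_action_cont[OF zkT], where t=UNIV])
          (auto intro: continuous_on_apply_bcontfun)
      \<comment> \<open>The nearby map \<open>g\<close> takes equal values at the two points, and
        \<open>f\<close> differs from it by at most 1 / (j + 1) at each.\<close>
      have b: "dist (apply_bcontfun f (T n (x j))) (apply_bcontfun f (T n (y j))) \<le> 2 / real (Suc j)" for j
      proof -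
        obtain g where g: "dist g f < 1 / real (Suc j)"
          "apply_bcontfun g (T n (x j)) = apply_bcontfun g (T n (y j))" using xy(1) by blast
        have "dist (apply_bcontfun f (T n (x j))) (apply_bcontfun f (T n (y j)))
          \<le> dist (apply_bcontfun f (T n (x j))) (apply_bcontfun g (T n (x j)))
            + dist (apply_bcontfun g (T n (x j))) (apply_bcontfun f (T n (y j)))" by (rule dist_triangle)
        also have "\<dots> \<le> dist f g + dist g f" unfolding g(2)[symmetric]
          using dist_bounded[of f "T n (x j)" g] dist_bounded[of g "T n (y j)" f] unfolding g(2)
          by (rule add_mono)
        also have "\<dots> \<le> 2 / real (Suc j)" using g(1) by (simp add: dist_commute)
        finally show ?thesis .
      qed
      have "(\<lambda>j. dist (apply_bcontfun f (T n (x (r j)))) (apply_bcontfun f (T n (y (r j)))))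
        \<longlonglongrightarrow> dist (apply_bcontfun f (T n (fst p))) (apply_bcontfun f (T n (snd p)))"
        by (intro tendsto_dist lim[OF fc] px py)
      moreover have "(\<lambda>j. dist (apply_bcontfun f (T n (x (r j)))) (apply_bcontfun f (T n (y (r j))))) \<longlonglongrightarrow> 0"
      proof (rule tendsto_sandwich[OF _ _ tendsto_const])
        have "(\<lambda>j. 2 * (1 / real (Suc j))) \<longlonglongrightarrow> 2 * 0"
          by (intro tendsto_mult tendsto_const LIMSEQ_Suc[OF lim_1_over_n])
        then have "(\<lambda>j. 2 / real (Suc j)) \<longlonglongrightarrow> 0" by simp
        from LIMSEQ_subseq_LIMSEQ[OF this r(1)] show "(\<lambda>j. 2 / real (Suc (r j))) \<longlonglongrightarrow> 0"
          by (simp only: o_def)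
      qed (use b in auto)
      ultimately have "dist (apply_bcontfun f (T n (fst p))) (apply_bcontfun f (T n (snd p))) = 0"
        by (rule LIMSEQ_unique)
      then show ?thesis by simp
    qed
    ultimately have "dist (fst p) (snd p) < \<epsilon>"
      using f unfolding fibre_embeddings_def I_map_def by blast
    moreover have "\<epsilon> \<le> dist (fst p) (snd p)"
      by (rule LIMSEQ_le_const[OF tendsto_dist[OF px py]]) (use xy(3) in blast)
    ultimately show False by simp
  qed
qed

lemma dense_fibre_embeddings:
  fixes T :: "int^'k \<Rightarrow> 'a::metric_space \<Rightarrow> 'a" and S :: "int^'k \<Rightarrow> 'z::metric_space \<Rightarrow> 'z"
  assumes S: "dyn_system S" "aperiodic S" "zero_dimensional_space TYPE('z)"
    and T: "dyn_system T" and ext: "extension T S \<pi>"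
    and md: "mdim T < ereal (real CARD('d) / 2)" and "\<epsilon> > 0"
  shows "CX_top closure_of fibre_embeddings T \<pi> \<epsilon> = topspace (CX_top :: ('a \<Rightarrow>\<^sub>C (real^'d)) topology)"
proof (intro equalityI subsetI)
  fix f :: "'a \<Rightarrow>\<^sub>C (real^'d)" assume f: "f \<in> topspace CX_top"
  then have fc: "\<And>x. apply_bcontfun f x \<in> unit_cube" by (simp add: CX_top_def)
  have cX: "compact (UNIV :: 'a set)" using T by (simp add: dyn_system_def)
  show "f \<in> CX_top closure_of fibre_embeddings T \<pi> \<epsilon>"
    unfolding in_closure_of
  proof (intro conjI allI impI f)
    fix V :: "('a \<Rightarrow>\<^sub>C (real^'d)) set" assume V: "f \<in> V \<and> openin CX_top V"
    then obtain e where e: "e > 0" "\<And>g. g \<in> topspace CX_top \<Longrightarrow> dist g f < e \<Longrightarrow> g \<in> V"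
      unfolding CX_top_def openin_euclidean_subtopology_iff by auto
    \<comment> \<open>The perturbation is controlled by a non-strict bound, while membership in
      \<open>V\<close> needs distance strictly below \<open>e\<close>.\<close>
    have e2: "e / 2 > 0" using e(1) by simp
    have fcont: "continuous_on UNIV (apply_bcontfun f)" by (rule continuous_on_apply_bcontfun)
    obtain g where g: "continuous_on UNIV g" "\<And>x. g x \<in> unit_cube"
      "\<And>x. norm (g x - apply_bcontfun f x) \<le> e / 2"
      "\<And>x y. \<pi> x = \<pi> y \<Longrightarrow> (\<And>n. g (T n x) = g (T n y)) \<Longrightarrow> dist x y < \<epsilon>"
      using extension_perturbation[OF S T ext md fcont fc \<open>\<epsilon> > 0\<close> e2] by blast
    have "g \<in> bcontfun"
      unfolding bcontfun_def using g(1) compact_imp_bounded[OF compact_continuous_image[OF g(1) cX]] by simp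
    then have app: "apply_bcontfun (Bcontfun g) = g" by (rule Bcontfun_inverse)
    have top: "Bcontfun g \<in> topspace CX_top" using g(2) by (simp add: CX_top_def app)
    have "dist (Bcontfun g) f \<le> e / 2"
      by (rule dist_bound) (simp only: app dist_norm g(3))
    then have "Bcontfun g \<in> V" using e top by simp
    moreover have "Bcontfun g \<in> fibre_embeddings T \<pi> \<epsilon>"
      unfolding fibre_embeddings_def
    proof (intro CollectI conjI allI impI top)
      fix x y assume "\<pi> x = \<pi> y" "I_map T (apply_bcontfun (Bcontfun g)) x = I_map T (apply_bcontfun (Bcontfun g)) y"
      then show "dist x y < \<epsilon>" by (intro g(4)) (simp_all add: app I_map_def fun_eq_iff)
    qed
    ultimately show "\<exists>y. y \<in> fibre_embeddings T \<pi> \<epsilon> \<and> y \<in> V" by blast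
  qed
qed (simp add: in_closure_of)

text \<open>The cube is closed, so the cube-valued maps form a closed subset of the complete space
  of bounded continuous functions; this is the setting for Baire's theorem.\<close>

lemma completely_metrizable_CX_top:
  "completely_metrizable_space (CX_top :: ('a::metric_space \<Rightarrow>\<^sub>C (real^'d)) topology)"
proof -
  have "{f :: 'a \<Rightarrow>\<^sub>C (real^'d). \<forall>x. apply_bcontfun f x \<in> unit_cube} = PiC UNIV (\<lambda>_. unit_cube)"
    by (auto simp: mem_PiC_iff Pi_iff)
  moreover have eq: "(unit_cube :: (real^'d) set) = cbox 0 1" by (auto simp: unit_cube_def mem_box_cart)
  have "closed (PiC UNIV (\<lambda>_. unit_cube) :: ('a \<Rightarrow>\<^sub>C (real^'d)) set)"
    by (rule closed_PiC) (simp only: eq closed_cbox)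
  ultimately show ?thesis unfolding CX_top_def
    by (intro completely_metrizable_space_closedin completely_metrizable_space_euclidean) simp
qed

theorem theorem3p1:
  fixes T :: "int^'k \<Rightarrow> 'a::metric_space \<Rightarrow> 'a"
    and S :: "int^'k \<Rightarrow> 'z::metric_space \<Rightarrow> 'z"
    and \<pi> :: "'a \<Rightarrow> 'z"
  assumes "dyn_system S" and "aperiodic S" and "zero_dimensional_space TYPE('z)"
    and "dyn_system T" and "extension T S \<pi>"
    and "mdim T < ereal (real CARD('d) / 2)"
  shows "\<exists>G. gdelta_in (CX_top :: ('a \<Rightarrow>\<^sub>C (real^'d)) topology) G \<and>
             CX_top closure_of G = topspace CX_top \<and>
             (\<forall>f\<in>G. embedding_map euclidean
                 (prod_topology (product_topology (\<lambda>_. top_of_set unit_cube) UNIV) euclidean)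
                 (\<lambda>x. (I_map T (apply_bcontfun f) x, \<pi> x)))"
proof -
  have zkT: "zk_action T" and cX: "compact (UNIV :: 'a set)" using assms(4) by (auto simp: dyn_system_def)
  have \<pi>c: "continuous_on UNIV \<pi>" using assms(5) by (simp add: extension_def)
  define \<G> :: "('a \<Rightarrow>\<^sub>C (real^'d)) set set" where "\<G> = range (\<lambda>j. fibre_embeddings T \<pi> (1 / real (Suc j)))"
  have cG: "countable \<G>" "\<G> \<noteq> {}" by (auto simp: \<G>_def)
  have op: "openin CX_top V" if "V \<in> \<G>" for V
    using that openin_fibre_embeddings[OF assms(4) \<pi>c] by (auto simp: \<G>_def)
  have de: "CX_top closure_of V = topspace CX_top" if "V \<in> \<G>" for V
    using that dense_fibre_embeddings[OF assms] by (auto simp: \<G>_def)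
  have "gdelta_in CX_top (\<Inter>\<G>)"
    using cG op by (intro gdelta_in_Inter open_imp_gdelta_in)
  moreover have "CX_top closure_of \<Inter>\<G> = topspace CX_top"
    by (rule Baire_category) (use completely_metrizable_CX_top cG op de in blast)+
  moreover have "embedding_map euclidean
      (prod_topology (product_topology (\<lambda>_. top_of_set unit_cube) UNIV) euclidean)
      (\<lambda>x. (I_map T (apply_bcontfun f) x, \<pi> x))" if f: "f \<in> \<Inter>\<G>" for f
  \<comment> \<open>X is compact and the target Hausdorff, so continuity and injectivity suffice;
    injectivity comes from using all scales 1 / (j + 1) at once.\<close>
  proof (rule continuous_imp_embedding_map)
    have fe: "f \<in> fibre_embeddings T \<pi> (1 / real (Suc j))" for j using f by (auto simp: \<G>_def)
    have cube: "apply_bcontfun f x \<in> unit_cube" for x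
      using fe[of 0] by (auto simp: fibre_embeddings_def CX_top_def)
    have fc: "continuous_on UNIV (\<lambda>x. apply_bcontfun f (T n x))" for n
      by (rule continuous_on_compose2[OF _ zk_action_cont[OF zkT], where t=UNIV])
        (auto intro: continuous_on_apply_bcontfun)
    have "continuous_map euclidean (product_topology (\<lambda>_. top_of_set unit_cube) UNIV) (I_map T (apply_bcontfun f))"
      unfolding continuous_map_componentwise_UNIV I_map_def
      using fc cube by (auto simp: continuous_map_in_subtopology)
    then show "continuous_map euclidean (prod_topology (product_topology (\<lambda>_. top_of_set unit_cube) UNIV) euclidean)
        (\<lambda>x. (I_map T (apply_bcontfun f) x, \<pi> x))"
      using \<pi>c by (intro continuous_map_pairedI) auto
    show "compact_space (euclidean :: 'a topology)" using cX by (simp add: compact_space_def)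
    show "Hausdorff_space (prod_topology (product_topology (\<lambda>_. top_of_set (unit_cube :: (real^'d) set)) (UNIV :: (int^'k) set)) (euclidean :: 'z topology))"
      by (simp add: Hausdorff_space_prod_topology Hausdorff_space_product_topology Hausdorff_space_subtopology)
    show "inj_on (\<lambda>x. (I_map T (apply_bcontfun f) x, \<pi> x)) (topspace euclidean)"
    proof (rule inj_onI)
      fix x y assume "(I_map T (apply_bcontfun f) x, \<pi> x) = (I_map T (apply_bcontfun f) y, \<pi> y)"
      then have *: "dist x y < 1 / real (Suc j)" for j
        using fe[of j] unfolding fibre_embeddings_def by blast
      show "x = y"
      proof (rule ccontr)
        assume "x \<noteq> y"
        then obtain j where "inverse (real (Suc j)) < dist x y" using reals_Archimedean[of "dist x y"] by auto
        then show False using *[of j] by (simp add: inverse_eq_divide)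
      qed
    qed
  qed
  ultimately show ?thesis by blast
qed

end
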